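(* Let $d$ be an even integer with $2\le d\le 8$, put $n=10-d$ and $N=2^{n/2}$, and let $\mathcal{H}_L$, $\mathcal{H}_R$ be separable complex Hilbert spaces. Let $X^i_L$ on $\mathcal{H}_L$ and $X^i_R$ on $\mathcal{H}_R$ ($i=d,\dots,9$) be self-adjoint (possibly unbounded) operators, with associated Dirac operator $\Delta$ on the Banach space $\mathcal{H}_{LR}=B(\mathcal{H}_R,\mathcal{H}_L)\otimes\mathbb{C}^{N}$, and assume that $\Delta^2$ is closed and has discrete spectrum. Let $\tilde X^i_L$ on $\mathcal{H}_L$ and $\tilde X^i_R$ on $\mathcal{H}_R$ ($i=d,\dots,9$) be self-adjoint (possibly unbounded) operators, with associated Dirac operator $\tilde\Delta$ on $\mathcal{H}_{LR}$. Assume that $\tilde\Delta^2$ and the anticommutator $\{\tilde\Delta,\Delta\}=\tilde\Delta\Delta+\Delta\tilde\Delta$ are both $\Delta^2$-bounded. Then there is a neighborhood $U\subset\mathbb{R}$ of $0$ such that $$\Xi(\Delta+\lambda\tilde\Delta)=\Xi(\Delta)\qquad\text{for all }\lambda\in U,$$ where $\Xi$ is the chirality index (defined in the context).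
   Context: **Space.** $B(\mathcal{H}_R,\mathcal{H}_L)$ is the space of bounded operators $\mathcal{H}_R\to\mathcal{H}_L$. $\mathcal{H}_{LR}=B(\mathcal{H}_R,\mathcal{H}_L)\otimes\mathbb{C}^N$ is a Banach space for the operator norm (elements viewed as bounded operators $\mathcal{H}_R\to\mathcal{H}_L\otimes\mathbb{C}^N$). **Gamma matrices and chirality.** $\delta_d,\dots,\delta_9$ are Hermitian $N\times N$ matrices generating the $n$-dimensional Euclidean Clifford algebra: $\delta_i\delta_j+\delta_j\delta_i=2\delta_{ij}\mathbb{1}$ (Kronecker delta on the right), acting on the factor $\mathbb{C}^N$. The chirality operator is $\theta=i^{-n/2}\,\delta_d\delta_{d+1}\cdots\delta_9$ (here $i=\sqrt{-1}$), acting on $\mathcal{H}_{LR}$ through the factor $\mathbb{C}^N$; it satisfies $\theta^2=1$. **Dirac operator.** The Dirac operator associated with self-adjoint operators $(X^i_L,X^i_R)_{i=d,\dots,9}$ is the (in general unbounded) operator on $\mathcal{H}_{LR}$ $$\Delta\Psi=\sum_{i=d}^{9}\delta_i\left(X^i_L\Psi-\Psi X^i_R\right),$$ and $\tilde\Delta$ is given by the same formula with $\tilde X^i_{L}$, $\tilde X^i_{R}$ in place of $X^i_L$, $X^i_R$. The domains of these operators are understood to be invariant under $\theta$, and $\theta\Delta=-\Delta\theta$, $\theta\tilde\Delta=-\tilde\Delta\theta$. The square of $\Delta+\lambda\tilde\Delta$ is understood as $\Delta^2+\lambda\{\tilde\Delta,\Delta\}+\lambda^2\tilde\Delta^2$ on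 the domain of $\Delta^2$. **Discrete spectrum.** The spectrum consists of isolated eigenvalues of finite algebraic multiplicity. **Relative boundedness.** For a closed operator $A$ on a Banach space, an operator $B$ is $A$-bounded if $D(A)\subset D(B)$ and there are positive constants $a,b$ with $\|Bx\|\le a\|Ax\|+b\|x\|$ for all $x\in D(A)$. **Index.** Let $\Gamma$ be a simple closed curve in $\mathbb{C}$ which encircles the origin and does not meet the spectrum of $\Delta^2$. For a Dirac operator $T$ such that $\Gamma$ does not meet the spectrum of $T^2$ and encircles only finitely many eigenvalues of $T^2$, of finite multiplicity, let $P_\Gamma(T^2)$ be the spectral (Riesz) projector onto the (generalized) eigenspaces of $T^2$ whose eigenvalues are encircled by $\Gamma$. The chirality index is $$\Xi(T)=\operatorname{Tr}_{\mathcal{H}_{LR}}\left(P_\Gamma(T^2)\,\theta\right).$$ For $\Delta$ the value does not depend on the choice of $\Gamma$. In the claim, $\Gamma$ is chosen once for $\Delta$ and the same $\Gamma$ is used for $\Delta+\lambda\tilde\Delta$; the assertion includes that $\Xi(\Delta+\lambda\tilde\Delta)$ is well defined for $\lambda\in U$. *)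

theory Defs
  imports "HOL-Complex_Analysis.Complex_Analysis"
begin

section \<open>Complex normed, inner product and Hilbert spaces\<close>

class complex_normed_vector = real_normed_vector +
  fixes scaleC :: "complex \<Rightarrow> 'a \<Rightarrow> 'a"  (infixr \<open>*\<^sub>C\<close> 75)
  assumes scaleC_add_right: "c *\<^sub>C (x + y) = c *\<^sub>C x + c *\<^sub>C y"
    and scaleC_add_left: "(c + c') *\<^sub>C x = c *\<^sub>C x + c' *\<^sub>C x"
    and scaleC_scaleC: "c *\<^sub>C c' *\<^sub>C x = (c * c') *\<^sub>C x"
    and scaleC_of_real: "complex_of_real r *\<^sub>C x = r *\<^sub>R x"
    and norm_scaleC: "norm (c *\<^sub>C x) = cmod c * norm x"

(* The inner product is linear in its second argument. *)
class complex_inner = complex_normed_vector + real_inner +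
  fixes cinner :: "'a \<Rightarrow> 'a \<Rightarrow> complex"
  assumes cinner_commute: "cinner x y = cnj (cinner y x)"
    and cinner_add_right: "cinner x (y + z) = cinner x y + cinner x z"
    and cinner_scaleC_right: "cinner x (c *\<^sub>C y) = c * cinner x y"
    and Re_cinner: "Re (cinner x y) = inner x y"

class complex_hilbert = complex_inner + complete_space
begin
subclass banach ..
end

lemma scaleC_one: "1 *\<^sub>C x = (x :: 'a :: complex_normed_vector)"
  using scaleC_of_real[of 1 x] by simp

global_interpretation complex_vector: vector_space "scaleC :: complex \<Rightarrow> 'a \<Rightarrow> 'a :: complex_normed_vector"
  defines csubspace = complex_vector.subspace and cspan = complex_vector.span
  by unfold_locales (simp_all add: scaleC_add_right scaleC_add_left scaleC_scaleC scaleC_one)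

lemma scaleC_scaleR_commute: "c *\<^sub>C (r *\<^sub>R x) = r *\<^sub>R (c *\<^sub>C (x :: 'a :: complex_normed_vector))"
  by (metis mult.commute scaleC_of_real scaleC_scaleC)

lemma bounded_linear_scaleC: "bounded_linear (\<lambda>x :: 'a :: complex_normed_vector. c *\<^sub>C x)"
  by (rule bounded_linear_intro[where K = "cmod c"])
     (simp_all add: scaleC_add_right scaleC_scaleR_commute norm_scaleC mult.commute)

instantiation complex :: complex_normed_vector
begin
definition scaleC_complex :: "complex \<Rightarrow> complex \<Rightarrow> complex" where
  "scaleC_complex c x = c * x"
instance
  by standard (simp_all add: scaleC_complex_def algebra_simps norm_mult scaleR_conv_of_real)
end

(* 'l ^ 'n, with its Euclidean sum norm, is the Hilbert space tensor product of 'l with \<complex>^n. *)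
instantiation vec :: (complex_normed_vector, finite) complex_normed_vector
begin
definition scaleC_vec :: "complex \<Rightarrow> 'a ^ 'b \<Rightarrow> 'a ^ 'b" where
  "scaleC_vec c x = (\<chi> i. c *\<^sub>C x $ i)"
instance
  by standard
     (simp_all add: scaleC_vec_def vec_eq_iff scaleC_add_right scaleC_add_left scaleC_scaleC
        scaleC_of_real norm_vec_def norm_scaleC L2_set_right_distrib)
end

instantiation complex :: complex_hilbert
begin
definition cinner_complex :: "complex \<Rightarrow> complex \<Rightarrow> complex" where
  "cinner_complex x y = cnj x * y"
instance
  by standard (simp_all add: cinner_complex_def scaleC_complex_def algebra_simps inner_complex_def)
end

instantiation vec :: (complex_hilbert, finite) complex_hilbert
begin
definition cinner_vec :: "'a ^ 'b \<Rightarrow> 'a ^ 'b \<Rightarrow> complex" where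
  "cinner_vec x y = (\<Sum>i\<in>UNIV. cinner (x $ i) (y $ i))"
instance
proof
  fix x y z :: "'a ^ 'b" and c :: complex
  show "cinner x y = cnj (cinner y x)"
    unfolding cinner_vec_def cnj_sum by (rule sum.cong[OF refl]) (rule cinner_commute)
  show "cinner x (y + z) = cinner x y + cinner x z"
    by (simp add: cinner_vec_def cinner_add_right sum.distrib)
  show "cinner x (c *\<^sub>C y) = c * cinner x y"
    by (simp add: cinner_vec_def scaleC_vec_def cinner_scaleC_right sum_distrib_left)
  show "Re (cinner x y) = inner x y"
    by (simp add: cinner_vec_def inner_vec_def Re_cinner)
qed
end


section \<open>The Banach space of bounded complex-linear operators\<close>

typedef (overloaded) ('a, 'b) cblinfun (\<open>(_ \<Rightarrow>\<^sub>C\<^sub>L /_)\<close> [22, 21] 21) =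
  "{f :: 'a :: complex_normed_vector \<Rightarrow> 'b :: complex_normed_vector.
     bounded_linear f \<and> (\<forall>c x. f (c *\<^sub>C x) = c *\<^sub>C f x)}"
  morphisms cblinfun_apply CBlinfun
  by (rule exI[of _ "\<lambda>_. 0"]) (simp add: complex_vector.scale_zero_right)

declare [[coercion cblinfun_apply]]

setup_lifting type_definition_cblinfun

lemma bounded_linear_cblinfun_apply: "bounded_linear (cblinfun_apply F)"
  using cblinfun_apply[of F] by simp

lemma cblinfun_apply_scaleC: "cblinfun_apply F (c *\<^sub>C x) = c *\<^sub>C cblinfun_apply F x"
  using cblinfun_apply[of F] by simp

lemma cblinfun_eqI: "(\<And>x. cblinfun_apply F x = cblinfun_apply G x) \<Longrightarrow> F = G"
  by (metis cblinfun_apply_inject ext)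

instantiation cblinfun :: (complex_normed_vector, complex_normed_vector) complex_normed_vector
begin

lift_definition zero_cblinfun :: "'a \<Rightarrow>\<^sub>C\<^sub>L 'b" is "\<lambda>_. 0"
  by (simp add: complex_vector.scale_zero_right)

lift_definition plus_cblinfun :: "'a \<Rightarrow>\<^sub>C\<^sub>L 'b \<Rightarrow> 'a \<Rightarrow>\<^sub>C\<^sub>L 'b \<Rightarrow> 'a \<Rightarrow>\<^sub>C\<^sub>L 'b" is "\<lambda>f g x. f x + g x"
  by (simp add: bounded_linear_add scaleC_add_right)

lift_definition uminus_cblinfun :: "'a \<Rightarrow>\<^sub>C\<^sub>L 'b \<Rightarrow> 'a \<Rightarrow>\<^sub>C\<^sub>L 'b" is "\<lambda>f x. - f x"
  by (simp add: bounded_linear_minus complex_vector.scale_minus_right)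

lift_definition minus_cblinfun :: "'a \<Rightarrow>\<^sub>C\<^sub>L 'b \<Rightarrow> 'a \<Rightarrow>\<^sub>C\<^sub>L 'b \<Rightarrow> 'a \<Rightarrow>\<^sub>C\<^sub>L 'b" is "\<lambda>f g x. f x - g x"
  by (simp add: bounded_linear_sub complex_vector.scale_right_diff_distrib)

lift_definition scaleC_cblinfun :: "complex \<Rightarrow> 'a \<Rightarrow>\<^sub>C\<^sub>L 'b \<Rightarrow> 'a \<Rightarrow>\<^sub>C\<^sub>L 'b" is "\<lambda>c f x. c *\<^sub>C f x"
  by (auto simp: scaleC_scaleC mult.commute
      intro: bounded_linear_compose[OF bounded_linear_scaleC])

lift_definition scaleR_cblinfun :: "real \<Rightarrow> 'a \<Rightarrow>\<^sub>C\<^sub>L 'b \<Rightarrow> 'a \<Rightarrow>\<^sub>C\<^sub>L 'b" is "\<lambda>r f x. r *\<^sub>R f x"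
  by (auto simp: scaleC_scaleR_commute intro: bounded_linear_compose[OF bounded_linear_scaleR_right])

lift_definition norm_cblinfun :: "'a \<Rightarrow>\<^sub>C\<^sub>L 'b \<Rightarrow> real" is onorm .

definition dist_cblinfun :: "'a \<Rightarrow>\<^sub>C\<^sub>L 'b \<Rightarrow> 'a \<Rightarrow>\<^sub>C\<^sub>L 'b \<Rightarrow> real" where
  "dist_cblinfun F G = norm (F - G)"

definition sgn_cblinfun :: "'a \<Rightarrow>\<^sub>C\<^sub>L 'b \<Rightarrow> 'a \<Rightarrow>\<^sub>C\<^sub>L 'b" where
  "sgn_cblinfun F = inverse (norm F) *\<^sub>R F"

definition uniformity_cblinfun :: "(('a \<Rightarrow>\<^sub>C\<^sub>L 'b) \<times> ('a \<Rightarrow>\<^sub>C\<^sub>L 'b)) filter" where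
  "uniformity_cblinfun = (INF e\<in>{0 <..}. principal {(F, G). dist F G < e})"

definition open_cblinfun :: "('a \<Rightarrow>\<^sub>C\<^sub>L 'b) set \<Rightarrow> bool" where
  "open_cblinfun U = (\<forall>F\<in>U. \<forall>\<^sub>F (F', G) in uniformity. F' = F \<longrightarrow> G \<in> U)"

instance
proof
  fix F G H :: "'a \<Rightarrow>\<^sub>C\<^sub>L 'b" and a b r :: real and c c' :: complex
  show "dist F G = norm (F - G)" by (rule dist_cblinfun_def)
  show "sgn F = inverse (norm F) *\<^sub>R F" by (rule sgn_cblinfun_def)
  show "uniformity = (INF e\<in>{0 <..}. principal {(F, G :: 'a \<Rightarrow>\<^sub>C\<^sub>L 'b). dist F G < e})"
    by (rule uniformity_cblinfun_def)
  show "open U = (\<forall>F\<in>U. \<forall>\<^sub>F (F', G) in uniformity. F' = F \<longrightarrow> G \<in> U)" for U :: "('a \<Rightarrow>\<^sub>C\<^sub>L 'b) set"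
    by (rule open_cblinfun_def)
  show "F + G + H = F + (G + H)" by transfer (simp add: add.assoc)
  show "F + G = G + F" by transfer (simp add: add.commute)
  show "0 + F = F" by transfer simp
  show "- F + F = 0" by transfer simp
  show "F - G = F + - G" by transfer simp
  show "a *\<^sub>R (F + G) = a *\<^sub>R F + a *\<^sub>R G" by transfer (simp add: scaleR_add_right)
  show "(a + b) *\<^sub>R F = a *\<^sub>R F + b *\<^sub>R F" by transfer (simp add: scaleR_add_left)
  show "a *\<^sub>R b *\<^sub>R F = (a * b) *\<^sub>R F" by transfer simp
  show "1 *\<^sub>R F = F" by transfer simp
  show "(norm F = 0) = (F = 0)" by transfer (metis onorm_eq_0)
  show "norm (F + G) \<le> norm F + norm G" by transfer (simp add: onorm_triangle)
  show "norm (a *\<^sub>R F) = \<bar>a\<bar> * norm F" by transfer (simp add: onorm_scaleR)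
  show "c *\<^sub>C (F + G) = c *\<^sub>C F + c *\<^sub>C G" by transfer (simp add: scaleC_add_right)
  show "(c + c') *\<^sub>C F = c *\<^sub>C F + c' *\<^sub>C F" by transfer (simp add: scaleC_add_left)
  show "c *\<^sub>C c' *\<^sub>C F = (c * c') *\<^sub>C F" by transfer (simp add: scaleC_scaleC)
  show "complex_of_real r *\<^sub>C F = r *\<^sub>R F" by transfer (simp add: scaleC_of_real)
  show "norm (c *\<^sub>C F) = cmod c * norm F"
  proof transfer
    fix c and f :: "'a \<Rightarrow> 'b"
    assume "bounded_linear f \<and> (\<forall>c x. f (c *\<^sub>C x) = c *\<^sub>C f x)"
    then have f: "bounded_linear f" by simp
    have "onorm (\<lambda>x. c *\<^sub>C f x) = onorm (\<lambda>x. cmod c *\<^sub>R f x)"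
      by (simp add: onorm_def norm_scaleC)
    then show "onorm (\<lambda>x. c *\<^sub>C f x) = cmod c * onorm f"
      using onorm_scaleR[OF f, of "cmod c"] by simp
  qed
qed

end

lemma norm_cblinfun_apply: "norm (cblinfun_apply F x) \<le> norm F * norm x"
  by transfer (simp add: onorm)

instance cblinfun :: (complex_normed_vector, "{complex_normed_vector, complete_space}") complete_space
proof
  fix X :: "nat \<Rightarrow> 'a \<Rightarrow>\<^sub>C\<^sub>L 'b"
  assume X: "Cauchy X"
  define B where "B n = Blinfun (cblinfun_apply (X n))" for n
  have B_apply: "blinfun_apply (B n) = cblinfun_apply (X n)" for n
    unfolding B_def by (rule bounded_linear_Blinfun_apply[OF bounded_linear_cblinfun_apply])
  have norm_B: "norm (B m - B n) = norm (X m - X n)" for m n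
  proof -
    have "blinfun_apply (B m - B n) = cblinfun_apply (X m - X n)"
      by (auto simp: blinfun.diff_left B_apply minus_cblinfun.rep_eq)
    then show ?thesis
      by (simp add: norm_blinfun.rep_eq norm_cblinfun.rep_eq)
  qed
  have conv: "\<exists>L. (\<lambda>n. blinfun_apply (B n) x) \<longlonglongrightarrow> L" for x
  proof -
    have "Cauchy B"
      using X unfolding Cauchy_def dist_norm norm_B .
    then have "Cauchy (\<lambda>n. blinfun_apply (B n) x)"
      by (rule bounded_linear.Cauchy[OF blinfun.bounded_linear_left])
    then show ?thesis
      using Cauchy_convergent_iff convergent_def by blast
  qed
  define f where "f x = lim (\<lambda>n. cblinfun_apply (X n) x)" for x
  have f: "(\<lambda>n. cblinfun_apply (X n) x) \<longlonglongrightarrow> f x" for x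
    using conv[of x] unfolding f_def B_apply by (auto simp: limI)
  have X': "\<exists>N. \<forall>m\<ge>N. \<forall>n\<ge>N. norm (X m - X n) < e" if "e > 0" for e
    using X that unfolding Cauchy_def dist_norm by blast
  have bound: "norm (cblinfun_apply (X m) x - f x) \<le> e * norm x"
    if "\<forall>m\<ge>N. \<forall>n\<ge>N. norm (X m - X n) < e" "m \<ge> N" for e N m x
  proof (rule tendsto_upperbound)
    show "(\<lambda>n. norm (cblinfun_apply (X m) x - cblinfun_apply (X n) x)) \<longlonglongrightarrow> norm (cblinfun_apply (X m) x - f x)"
      by (intro tendsto_intros f)
    show "\<forall>\<^sub>F n in sequentially. norm (cblinfun_apply (X m) x - cblinfun_apply (X n) x) \<le> e * norm x"
    proof (rule eventually_sequentiallyI[of N])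
      fix n assume n: "N \<le> n"
      have "norm (cblinfun_apply (X m) x - cblinfun_apply (X n) x) \<le> norm (X m - X n) * norm x"
        using norm_cblinfun_apply[of "X m - X n" x] by (simp add: minus_cblinfun.rep_eq)
      also have "\<dots> \<le> e * norm x"
        using that n by (intro mult_right_mono) (auto intro: less_imp_le)
      finally show "norm (cblinfun_apply (X m) x - cblinfun_apply (X n) x) \<le> e * norm x" .
    qed
  qed simp
  interpret Xl: bounded_linear "cblinfun_apply (X n)" for n
    by (rule bounded_linear_cblinfun_apply)
  obtain N where N: "\<forall>m\<ge>N. \<forall>n\<ge>N. norm (X m - X n) < 1"
    using X'[of 1] by auto
  have "bounded_linear f"
  proof (rule bounded_linear_intro[where K = "1 + norm (X N)"])
    show "f (x + y) = f x + f y" for x y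
      using LIMSEQ_unique[OF f[of "x + y"]] tendsto_add[OF f[of x] f[of y]]
      by (simp add: Xl.add)
    show "f (r *\<^sub>R x) = r *\<^sub>R f x" for r x
      using LIMSEQ_unique[OF f[of "r *\<^sub>R x"]] tendsto_scaleR[OF tendsto_const f[of x], of r]
      by (simp add: Xl.scaleR)
    show "norm (f x) \<le> norm x * (1 + norm (X N))" for x
    proof -
      have "norm (f x) \<le> norm (cblinfun_apply (X N) x - f x) + norm (cblinfun_apply (X N) x)"
        by (metis norm_minus_commute norm_triangle_sub add.commute)
      also have "\<dots> \<le> 1 * norm x + norm (X N) * norm x"
        by (intro add_mono bound[OF N] norm_cblinfun_apply) simp
      finally show ?thesis by (simp add: algebra_simps)
    qed
  qed
  moreover have "f (c *\<^sub>C x) = c *\<^sub>C f x" for c x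
    using LIMSEQ_unique[OF f[of "c *\<^sub>C x"]] bounded_linear.tendsto[OF bounded_linear_scaleC f[of x], of c]
    by (simp add: cblinfun_apply_scaleC)
  ultimately have L: "cblinfun_apply (CBlinfun f) = f"
    by (simp add: CBlinfun_inverse)
  have "X \<longlonglongrightarrow> CBlinfun f"
  proof (rule LIMSEQ_I)
    fix r :: real assume "r > 0"
    then obtain N where N: "\<forall>m\<ge>N. \<forall>n\<ge>N. norm (X m - X n) < r / 2"
      using X'[of "r / 2"] by auto
    have "norm (X n - CBlinfun f) < r" if "n \<ge> N" for n
    proof -
      have "norm (X n - CBlinfun f) \<le> r / 2"
        unfolding norm_cblinfun.rep_eq
        by (rule onorm_bound) (use \<open>r > 0\<close> bound[OF N that] in \<open>simp_all add: minus_cblinfun.rep_eq L\<close>)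
      then show ?thesis using \<open>r > 0\<close> by simp
    qed
    then show "\<exists>N. \<forall>n\<ge>N. norm (X n - CBlinfun f) < r" by blast
  qed
  then show "convergent X"
    by (rule convergentI)
qed

instance cblinfun :: (complex_normed_vector, "{complex_normed_vector, complete_space}") banach ..


section \<open>Unbounded operators\<close>

(* A partially defined operator: the values of App outside Dom carry no meaning, and no notion
   below refers to them. *)
datatype 'a operator = Op (Dom: "'a set") (App: "'a \<Rightarrow> 'a")

definition linear_operator :: "'a :: complex_normed_vector operator \<Rightarrow> bool" where
  "linear_operator A \<longleftrightarrow> csubspace (Dom A) \<and>
     (\<forall>x\<in>Dom A. \<forall>y\<in>Dom A. App A (x + y) = App A x + App A y) \<and>
     (\<forall>c. \<forall>x\<in>Dom A. App A (c *\<^sub>C x) = c *\<^sub>C App A x)"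

definition closed_operator :: "'a :: complex_normed_vector operator \<Rightarrow> bool" where
  "closed_operator A \<longleftrightarrow> closed {(x, App A x) | x. x \<in> Dom A}"

definition op_add :: "'a :: complex_normed_vector operator \<Rightarrow> 'a operator \<Rightarrow> 'a operator" where
  "op_add A B = Op (Dom A \<inter> Dom B) (\<lambda>x. App A x + App B x)"

definition op_scale :: "complex \<Rightarrow> 'a :: complex_normed_vector operator \<Rightarrow> 'a operator" where
  "op_scale c A = Op (Dom A) (\<lambda>x. c *\<^sub>C App A x)"

definition op_comp :: "'a operator \<Rightarrow> 'a operator \<Rightarrow> 'a operator" where
  "op_comp A B = Op {x \<in> Dom B. App B x \<in> Dom A} (\<lambda>x. App A (App B x))"

definition op_square :: "'a operator \<Rightarrow> 'a operator" where
  "op_square A = op_comp A A"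

definition anticommutator :: "'a :: complex_normed_vector operator \<Rightarrow> 'a operator \<Rightarrow> 'a operator" where
  "anticommutator A B = op_add (op_comp A B) (op_comp B A)"

definition relatively_bounded ::
  "'a :: complex_normed_vector operator \<Rightarrow> 'a operator \<Rightarrow> bool" where
  "relatively_bounded A B \<longleftrightarrow> Dom A \<subseteq> Dom B \<and>
     (\<exists>a>0. \<exists>b>0. \<forall>x\<in>Dom A. norm (App B x) \<le> a * norm (App A x) + b * norm x)"

(* The second condition says that A and its adjoint have the same graph. *)
definition self_adjoint :: "'a :: complex_hilbert operator \<Rightarrow> bool" where
  "self_adjoint A \<longleftrightarrow> linear_operator A \<and> closure (Dom A) = UNIV \<and>
     (\<forall>y z. (\<forall>x\<in>Dom A. cinner (App A x) y = cinner x z) \<longleftrightarrow> y \<in> Dom A \<and> App A y = z)"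


section \<open>Spectrum and Riesz projectors\<close>

definition is_resolvent ::
  "'a :: complex_normed_vector operator \<Rightarrow> complex \<Rightarrow> ('a \<Rightarrow>\<^sub>C\<^sub>L 'a) \<Rightarrow> bool" where
  "is_resolvent A z R \<longleftrightarrow>
     (\<forall>y. R y \<in> Dom A \<and> z *\<^sub>C R y - App A (R y) = y) \<and>
     (\<forall>x\<in>Dom A. R (z *\<^sub>C x - App A x) = x)"

definition spectrum :: "'a :: complex_normed_vector operator \<Rightarrow> complex set" where
  "spectrum A = {z. \<not> (\<exists>R. is_resolvent A z R)}"

definition resolvent :: "'a :: complex_normed_vector operator \<Rightarrow> complex \<Rightarrow> 'a \<Rightarrow>\<^sub>C\<^sub>L 'a" where
  "resolvent A z = (THE R. is_resolvent A z R)"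

(* The vector-valued counterpart of contour_integral. *)
definition contour_integralC ::
  "(real \<Rightarrow> complex) \<Rightarrow> (complex \<Rightarrow> 'a :: complex_normed_vector) \<Rightarrow> 'a" where
  "contour_integralC \<gamma> F =
     integral {0..1} (\<lambda>t. vector_derivative \<gamma> (at t within {0..1}) *\<^sub>C F (\<gamma> t))"

(* The Riesz projector of an isolated point mu of the spectrum; by Cauchy's theorem the
   integral does not depend on r once r is small. *)
definition eigenprojection ::
  "'a :: complex_normed_vector operator \<Rightarrow> complex \<Rightarrow> 'a \<Rightarrow>\<^sub>C\<^sub>L 'a" where
  "eigenprojection A \<mu> = (THE P. \<forall>\<^sub>F r in at_right 0.
     (1 / (2 * pi * \<i>)) *\<^sub>C contour_integralC (circlepath \<mu> r) (resolvent A) = P)"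

definition eigenvalue :: "'a :: complex_normed_vector operator \<Rightarrow> complex \<Rightarrow> bool" where
  "eigenvalue A \<mu> \<longleftrightarrow> (\<exists>x\<in>Dom A. x \<noteq> 0 \<and> App A x = \<mu> *\<^sub>C x)"

definition finite_rank :: "('a :: complex_normed_vector \<Rightarrow> 'a) \<Rightarrow> bool" where
  "finite_rank F \<longleftrightarrow> (\<exists>B. finite B \<and> range F \<subseteq> cspan B)"

(* The algebraic multiplicity of an isolated eigenvalue is the rank of its Riesz projector. *)
definition discrete_eigenvalue :: "'a :: complex_normed_vector operator \<Rightarrow> complex \<Rightarrow> bool" where
  "discrete_eigenvalue A \<mu> \<longleftrightarrow>
     \<mu> isolated_in spectrum A \<and> eigenvalue A \<mu> \<and> finite_rank (eigenprojection A \<mu>)"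

definition discrete_spectrum :: "'a :: complex_normed_vector operator \<Rightarrow> bool" where
  "discrete_spectrum A \<longleftrightarrow> (\<forall>\<mu>\<in>spectrum A. discrete_eigenvalue A \<mu>)"

definition encircled_spectrum ::
  "(real \<Rightarrow> complex) \<Rightarrow> 'a :: complex_normed_vector operator \<Rightarrow> complex set" where
  "encircled_spectrum \<Gamma> A = spectrum A \<inter> inside (path_image \<Gamma>)"

definition riesz_admissible ::
  "(real \<Rightarrow> complex) \<Rightarrow> 'a :: complex_normed_vector operator \<Rightarrow> bool" where
  "riesz_admissible \<Gamma> A \<longleftrightarrow> path_image \<Gamma> \<inter> spectrum A = {} \<and>
     finite (encircled_spectrum \<Gamma> A) \<and> (\<forall>\<mu>\<in>encircled_spectrum \<Gamma> A. discrete_eigenvalue A \<mu>)"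

(* For a piecewise smooth, positively oriented \<Gamma> this is the integral of the resolvent along \<Gamma>,
   divided by 2 pi i; small circles around the encircled eigenvalues make sense for every simple
   closed curve, whatever its regularity and orientation. *)
definition riesz_projector ::
  "(real \<Rightarrow> complex) \<Rightarrow> 'a :: complex_normed_vector operator \<Rightarrow> 'a \<Rightarrow>\<^sub>C\<^sub>L 'a" where
  "riesz_projector \<Gamma> A = (\<Sum>\<mu>\<in>encircled_spectrum \<Gamma> A. eigenprojection A \<mu>)"

(* The trace of a bounded finite rank operator on a Banach space. *)
definition finite_rank_trace :: "('a :: complex_normed_vector \<Rightarrow> 'a) \<Rightarrow> complex" where
  "finite_rank_trace F = (THE t. \<exists>(n :: nat) (\<phi> :: nat \<Rightarrow> 'a \<Rightarrow>\<^sub>C\<^sub>L complex) e.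
     (\<forall>x. F x = (\<Sum>k<n. \<phi> k x *\<^sub>C e k)) \<and> t = (\<Sum>k<n. \<phi> k (e k)))"


section \<open>Gamma matrices, Dirac operators and the chirality index\<close>

definition gamma_matrices :: "nat \<Rightarrow> (nat \<Rightarrow> complex ^ 'n ^ 'n) \<Rightarrow> bool" where
  "gamma_matrices d \<delta> \<longleftrightarrow>
     (\<forall>i\<in>{d..9}. \<forall>a b. \<delta> i $ a $ b = cnj (\<delta> i $ b $ a)) \<and>
     (\<forall>i\<in>{d..9}. \<forall>j\<in>{d..9}. \<delta> i ** \<delta> j + \<delta> j ** \<delta> i = (if i = j then mat 2 else 0))"

definition chirality_matrix :: "nat \<Rightarrow> (nat \<Rightarrow> complex ^ 'n ^ 'n) \<Rightarrow> complex ^ 'n ^ 'n" where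
  "chirality_matrix d \<delta> =
     mat (\<i> powi (- int ((10 - d) div 2))) ** foldr (**) (map \<delta> [d..<10]) (mat 1)"

(* The action of a matrix on the second factor of the tensor product of 'l with \<complex>^n. *)
definition mat_act :: "complex ^ 'n ^ 'n \<Rightarrow> 'l :: complex_normed_vector ^ 'n \<Rightarrow> 'l ^ 'n" where
  "mat_act M w = (\<chi> a. \<Sum>b\<in>UNIV. M $ a $ b *\<^sub>C w $ b)"

lemma bounded_linear_mat_act: "bounded_linear (mat_act M :: 'l :: complex_normed_vector ^ 'n \<Rightarrow> 'l ^ 'n)"
proof (rule bounded_linear_intro[where K = "\<Sum>a\<in>UNIV. \<Sum>b\<in>UNIV. cmod (M $ a $ b)"])
  fix w w' :: "'l ^ 'n" and r :: real
  show "mat_act M (w + w') = mat_act M w + mat_act M w'"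
    by (simp add: mat_act_def vec_eq_iff scaleC_add_right sum.distrib)
  show "mat_act M (r *\<^sub>R w) = r *\<^sub>R mat_act M w"
    by (simp add: mat_act_def vec_eq_iff scaleC_scaleR_commute scaleR_sum_right)
  have "norm (mat_act M w) \<le> (\<Sum>a\<in>UNIV. norm (mat_act M w $ a))"
    unfolding norm_vec_def by (rule L2_set_le_sum) simp
  also have "\<dots> \<le> (\<Sum>a\<in>UNIV. \<Sum>b\<in>UNIV. cmod (M $ a $ b) * norm w)"
    by (intro sum_mono) (auto simp: mat_act_def norm_scaleC
        intro!: sum_norm_le mult_left_mono Finite_Cartesian_Product.norm_nth_le)
  also have "\<dots> = norm w * (\<Sum>a\<in>UNIV. \<Sum>b\<in>UNIV. cmod (M $ a $ b))"
    by (simp add: sum_distrib_left mult.commute)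
  finally show "norm (mat_act M w) \<le> norm w * (\<Sum>a\<in>UNIV. \<Sum>b\<in>UNIV. cmod (M $ a $ b))" .
qed

lemma mat_act_scaleC: "mat_act M (c *\<^sub>C w) = c *\<^sub>C mat_act M w"
  by (simp add: mat_act_def vec_eq_iff scaleC_vec_def scaleC_scaleC complex_vector.scale_sum_right mult.commute)

lift_definition mat_act_op ::
  "complex ^ 'n ^ 'n \<Rightarrow> 'r :: complex_normed_vector \<Rightarrow>\<^sub>C\<^sub>L ('l :: complex_normed_vector ^ 'n) \<Rightarrow> 'r \<Rightarrow>\<^sub>C\<^sub>L ('l ^ 'n)"
  is "\<lambda>M \<Psi> v. mat_act M (\<Psi> v)"
  by (auto simp: mat_act_scaleC intro: bounded_linear_compose[OF bounded_linear_mat_act])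

(* Sums and products of unbounded operators are only defined on a subspace: \<Phi> is the bounded
   operator which on the common domain of the XR i is given by the sum over i of
   delta_i (XL i \<Psi> - \<Psi> XR i). It is determined by \<Psi> when that common domain is dense. *)
definition dirac_formula ::
  "nat \<Rightarrow> (nat \<Rightarrow> complex ^ 'n ^ 'n) \<Rightarrow> (nat \<Rightarrow> 'l :: complex_hilbert operator) \<Rightarrow>
   (nat \<Rightarrow> 'r :: complex_hilbert operator) \<Rightarrow> ('r \<Rightarrow>\<^sub>C\<^sub>L ('l ^ 'n)) \<Rightarrow> ('r \<Rightarrow>\<^sub>C\<^sub>L ('l ^ 'n)) \<Rightarrow> bool" where
  "dirac_formula d \<delta> XL XR \<Psi> \<Phi> \<longleftrightarrow> (\<forall>v \<in> (\<Inter>i\<in>{d..9}. Dom (XR i)).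
     (\<forall>i\<in>{d..9}. \<forall>b. \<Psi> v $ b \<in> Dom (XL i)) \<and>
     \<Phi> v = (\<Sum>i\<in>{d..9}. mat_act (\<delta> i)
              ((\<chi> b. App (XL i) (\<Psi> v $ b)) - \<Psi> (App (XR i) v))))"

(* The XL i, XR i do not prescribe the domain: any \<theta>-invariant subspace on which the formula makes
   sense is admitted. The anticommutation with \<theta> is a consequence of the formula when the common
   domain of the XR i is dense. *)
definition dirac_operator ::
  "nat \<Rightarrow> (nat \<Rightarrow> complex ^ 'n ^ 'n) \<Rightarrow> (nat \<Rightarrow> 'l :: complex_hilbert operator) \<Rightarrow>
   (nat \<Rightarrow> 'r :: complex_hilbert operator) \<Rightarrow> ('r \<Rightarrow>\<^sub>C\<^sub>L ('l ^ 'n)) operator \<Rightarrow> bool" where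
  "dirac_operator d \<delta> XL XR \<Delta> \<longleftrightarrow> linear_operator \<Delta> \<and>
     (\<forall>\<Psi>\<in>Dom \<Delta>. dirac_formula d \<delta> XL XR \<Psi> (App \<Delta> \<Psi>)) \<and>
     (let \<theta> = mat_act_op (chirality_matrix d \<delta>) in
        \<forall>\<Psi>\<in>Dom \<Delta>. \<theta> \<Psi> \<in> Dom \<Delta> \<and> \<theta> (App \<Delta> \<Psi>) = - App \<Delta> (\<theta> \<Psi>))"

(* The square of \<Delta> + c \<Delta>'; its domain is that of the square of \<Delta> as soon as the other
   two terms are bounded relative to the latter. *)
definition perturbed_square ::
  "'a :: complex_normed_vector operator \<Rightarrow> 'a operator \<Rightarrow> complex \<Rightarrow> 'a operator" where
  "perturbed_square \<Delta> \<Delta>' c =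
     op_add (op_square \<Delta>) (op_add (op_scale c (anticommutator \<Delta>' \<Delta>)) (op_scale (c\<^sup>2) (op_square \<Delta>')))"

(* A Dirac operator T enters only through its square S. *)
definition chirality_index ::
  "nat \<Rightarrow> (nat \<Rightarrow> complex ^ 'n ^ 'n) \<Rightarrow> (real \<Rightarrow> complex) \<Rightarrow>
   ('r :: complex_hilbert \<Rightarrow>\<^sub>C\<^sub>L ('l :: complex_hilbert ^ 'n)) operator \<Rightarrow> complex" where
  "chirality_index d \<delta> \<Gamma> S =
     finite_rank_trace (\<lambda>\<Psi>. riesz_projector \<Gamma> S (mat_act_op (chirality_matrix d \<delta>) \<Psi>))"

end

(* The resolvent of Delta^2 + B depends continuously on a relatively small perturbation B, uniformly
   on compact subsets of the resolvent set. Small circles around the encircled eigenvalues of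
   Delta^2 therefore stay in the resolvent set, and the sum P' of the Riesz integrals over these
   circles is norm-close to the unperturbed projector P. Then W = P' P + (1 - P') (1 - P) is
   invertible, intertwines P and P', and commutes with theta because the squares do. So P' has
   finite rank, which forces the perturbed spectrum inside the circles to be discrete, and
   P' theta = W (P theta) W^-1 has the same trace as P theta.

   Cauchy's theorem for operator-valued integrals is reduced to complex-valued functions by means
   of a separating family of bounded functionals, here Psi -> <w, Psi v>. *)

theory Submission
  imports Defs
begin

section \<open>Bounded operators\<close>

text \<open>The curve is merely continuous and simple, so nothing is integrated along it: it enters
  through its image and its inside, and all integrals run over circles. The obstacle is that the
  perturbed spectrum inside these circles is unknown at first, while the projector in the claim is a
  sum over that spectrum. Hence P' is defined by integrals alone, its rank is read off from
  similarity with P, and only then is the spectrum studied: z - A splits along each disc projector,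
  is inverted by a Cauchy integral on the kernel and by polynomial algebra on the finite-dimensional
  range, and this leaves finitely many exceptional z. The residue theorem finally identifies P' with
  the sum of eigenprojections. The trace is a definite description over all finite rank
  representations; conjugation by W carries representations to representations, so both descriptions
  select the same number.\<close>

lift_definition cblinfun_id :: "'a :: complex_normed_vector \<Rightarrow>\<^sub>C\<^sub>L 'a" is "\<lambda>x. x"
  by simp

lift_definition cblinfun_compose ::
  "'b :: complex_normed_vector \<Rightarrow>\<^sub>C\<^sub>L 'c :: complex_normed_vector \<Rightarrow>
   'a :: complex_normed_vector \<Rightarrow>\<^sub>C\<^sub>L 'b \<Rightarrow> 'a \<Rightarrow>\<^sub>C\<^sub>L 'c" (infixl \<open>o\<^sub>C\<^sub>L\<close> 70)
  is "\<lambda>f g x. f (g x)"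
  by (auto intro: bounded_linear_compose)

lemmas cblinfun_rep = plus_cblinfun.rep_eq minus_cblinfun.rep_eq uminus_cblinfun.rep_eq
  zero_cblinfun.rep_eq scaleC_cblinfun.rep_eq cblinfun_id.rep_eq cblinfun_compose.rep_eq

lemma cblinfun_add: "cblinfun_apply F (x + y) = cblinfun_apply F x + cblinfun_apply F y"
  and cblinfun_diff: "cblinfun_apply F (x - y) = cblinfun_apply F x - cblinfun_apply F y"
  and cblinfun_minus: "cblinfun_apply F (- x) = - cblinfun_apply F x"
  and cblinfun_zero: "cblinfun_apply F 0 = 0"
  and cblinfun_sum: "cblinfun_apply F (sum f I) = (\<Sum>i\<in>I. cblinfun_apply F (f i))"
proof -
  interpret bounded_linear "cblinfun_apply F" by (rule bounded_linear_cblinfun_apply)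
  show "cblinfun_apply F (x + y) = cblinfun_apply F x + cblinfun_apply F y"
    "cblinfun_apply F (x - y) = cblinfun_apply F x - cblinfun_apply F y"
    "cblinfun_apply F (- x) = - cblinfun_apply F x" "cblinfun_apply F 0 = 0"
    "cblinfun_apply F (sum f I) = (\<Sum>i\<in>I. cblinfun_apply F (f i))"
    by (rule add diff neg zero sum)+
qed

lemmas cblinfun_linear = cblinfun_add cblinfun_diff cblinfun_minus cblinfun_zero cblinfun_apply_scaleC

lemma sum_cblinfun_apply: "cblinfun_apply (sum F I) x = (\<Sum>i\<in>I. cblinfun_apply (F i) x)"
  by (induction I rule: infinite_finite_induct) (simp_all add: cblinfun_rep)

lemma norm_cblinfun_bound:
  assumes "0 \<le> b" "\<And>x. norm (cblinfun_apply F x) \<le> b * norm x"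
  shows "norm F \<le> b"
  unfolding norm_cblinfun.rep_eq using assms by (rule onorm_bound)

lemma norm_cblinfun_compose: "norm (F o\<^sub>C\<^sub>L G) \<le> norm F * norm G"
proof (rule norm_cblinfun_bound)
  fix x
  have "norm (F (G x)) \<le> norm F * (norm G * norm x)"
    by (rule order_trans[OF norm_cblinfun_apply]) (intro mult_left_mono norm_cblinfun_apply norm_ge_zero)
  then show "norm ((F o\<^sub>C\<^sub>L G) x) \<le> norm F * norm G * norm x"
    by (simp add: cblinfun_rep mult.assoc)
qed simp

lemma CBlinfun_apply:
  assumes "\<And>x y. f (x + y) = f x + f y" "\<And>c x. f (c *\<^sub>C x) = c *\<^sub>C f x"
    "\<And>x. norm (f x) \<le> b * norm x"
  shows "cblinfun_apply (CBlinfun f) = f"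
proof (rule CBlinfun_inverse)
  have "bounded_linear f"
    by (rule bounded_linear_intro[where K = b])
       (use assms in \<open>simp_all flip: scaleC_of_real add: mult.commute\<close>)
  with assms(2) show "f \<in> {f. bounded_linear f \<and> (\<forall>c x. f (c *\<^sub>C x) = c *\<^sub>C f x)}"
    by simp
qed

text \<open>The contraction x -> y + S x has exactly one fixed point N y. Uniqueness yields both the
  linearity of N and the left inverse; N x - x = S (N x) yields the last bound, which later measures
  how far a resolvent moves.\<close>

lemma neumann_inverse:
  fixes S :: "'a :: {complex_normed_vector, banach} \<Rightarrow>\<^sub>C\<^sub>L 'a"
  assumes S: "\<And>x. norm (S x) \<le> q * norm x" and q: "0 \<le> q" "q < 1"
  obtains N :: "'a \<Rightarrow>\<^sub>C\<^sub>L 'a" where "\<And>x. N x - S (N x) = x" "\<And>x. N (x - S x) = x"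
    "\<And>x. norm (N x - x) \<le> q / (1 - q) * norm x"
proof -
  have ex1: "\<exists>!x. y + S x = x" for y
    by (rule banach_fix_type[OF q])
       (use S in \<open>auto simp: dist_norm simp flip: cblinfun_diff\<close>)
  define n where "n y = (THE x. y + S x = x)" for y
  have n: "y + S (n y) = n y" for y
    unfolding n_def by (rule theI'[OF ex1])
  have n_eqI: "n y = x" if "y + S x = x" for x y
    using ex1[of y] n[of y] that by blast
  have bound: "norm (n y) \<le> 1 / (1 - q) * norm y" for y
  proof -
    have "norm (n y) \<le> norm y + q * norm (n y)"
      using norm_triangle_ineq[of y "S (n y)"] S[of "n y"] n[of y] by simp
    then have "(1 - q) * norm (n y) \<le> norm y" by (simp add: algebra_simps)
    then show ?thesis using q by (simp add: field_simps)
  qed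
  have N: "cblinfun_apply (CBlinfun n) = n"
  proof (rule CBlinfun_apply[OF _ _ bound])
    show "n (x + y) = n x + n y" for x y
    proof (rule n_eqI)
      have "x + y + S (n x + n y) = (x + S (n x)) + (y + S (n y))"
        by (simp add: cblinfun_linear algebra_simps)
      then show "x + y + S (n x + n y) = n x + n y" by (simp only: n)
    qed
    show "n (c *\<^sub>C x) = c *\<^sub>C n x" for c x
      by (rule n_eqI) (metis cblinfun_apply_scaleC n scaleC_add_right)
  qed
  show thesis
  proof
    fix x
    show "CBlinfun n x - S (CBlinfun n x) = x"
      unfolding N by (metis n add_diff_cancel_right')
    show "CBlinfun n (x - S x) = x"
      unfolding N by (rule n_eqI) simp
    have "norm (n x - x) = norm (S (n x))"
      by (metis n add_diff_cancel_left')
    also have "\<dots> \<le> q * (1 / (1 - q) * norm x)"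
      by (rule order_trans[OF S]) (intro mult_left_mono bound q)
    finally show "norm (CBlinfun n x - x) \<le> q / (1 - q) * norm x"
      by (simp add: N)
  qed
qed

section \<open>Resolvents\<close>

lemma is_resolvent_unique:
  assumes "is_resolvent A z R" "is_resolvent A z R'"
  shows "R = R'"
proof (rule cblinfun_eqI)
  fix y
  show "R y = R' y"
    using assms unfolding is_resolvent_def by metis
qed

lemma resolvent_eqI: "is_resolvent A z R \<Longrightarrow> resolvent A z = R"
  unfolding resolvent_def using is_resolvent_unique by blast

lemma is_resolvent_resolvent: "z \<notin> spectrum A \<Longrightarrow> is_resolvent A z (resolvent A z)"
  unfolding spectrum_def using resolvent_eqI by fastforce

lemma not_in_spectrumI: "is_resolvent A z R \<Longrightarrow> z \<notin> spectrum A"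
  unfolding spectrum_def by blast

text \<open>A shift of the parameter and a change of the operator are treated together: both make (w
  - A') R = 1 - s with a small bounded s, so R (1 - s)^-1 is a right inverse of w - A'. It is a left
  inverse because w - A' = (1 - s) (z - A) on the common domain.\<close>

lemma is_resolvent_perturb:
  fixes A A' :: "'a :: {complex_normed_vector, banach} operator"
  assumes A': "linear_operator A'" and Dom: "Dom A' = Dom A" and R: "is_resolvent A z R"
    and q: "0 \<le> q" "q < 1"
    and bound: "\<And>y. norm (w *\<^sub>C R y - App A' (R y) - y) \<le> q * norm y"
  obtains R' where "is_resolvent A' w R'" "norm (R' - R) \<le> norm R * (q / (1 - q))"
proof -
  let ?s = "\<lambda>y. y - (w *\<^sub>C R y - App A' (R y))"
  have R_Dom: "R y \<in> Dom A'" for y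
    using R Dom unfolding is_resolvent_def by simp
  have s: "cblinfun_apply (CBlinfun ?s) = ?s"
  proof (rule CBlinfun_apply)
    show "norm (?s y) \<le> q * norm y" for y
      using bound[of y] by (simp add: norm_minus_commute)
  qed (use A' R_Dom in \<open>auto simp: linear_operator_def cblinfun_linear scaleC_add_right
        scaleC_scaleC mult.commute complex_vector.scale_right_diff_distrib\<close>)
  obtain N :: "'a \<Rightarrow>\<^sub>C\<^sub>L 'a" where N: "\<And>x. N x - CBlinfun ?s (N x) = x" "\<And>x. N (x - CBlinfun ?s x) = x"
    "\<And>x. norm (N x - x) \<le> q / (1 - q) * norm x"
    by (rule neumann_inverse[of "CBlinfun ?s" q])
       (use bound q in \<open>auto simp: s norm_minus_commute\<close>)
  show thesis
  proof
    show "is_resolvent A' w (R o\<^sub>C\<^sub>L N)"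
      unfolding is_resolvent_def
    proof (intro conjI allI ballI)
      fix y
      show "(R o\<^sub>C\<^sub>L N) y \<in> Dom A'" by (simp add: cblinfun_rep R_Dom)
      show "w *\<^sub>C (R o\<^sub>C\<^sub>L N) y - App A' ((R o\<^sub>C\<^sub>L N) y) = y"
        using N(1)[of y] by (simp add: cblinfun_rep s)
    next
      fix x assume "x \<in> Dom A'"
      then have x: "R (z *\<^sub>C x - App A x) = x"
        using R Dom unfolding is_resolvent_def by simp
      show "(R o\<^sub>C\<^sub>L N) (w *\<^sub>C x - App A' x) = x"
        using N(2)[of "z *\<^sub>C x - App A x"] by (simp add: cblinfun_rep s x)
    qed
    show "norm (R o\<^sub>C\<^sub>L N - R) \<le> norm R * (q / (1 - q))"
    proof (rule norm_cblinfun_bound)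
      fix x
      have "norm ((R o\<^sub>C\<^sub>L N - R) x) = norm (R (N x - x))"
        by (simp add: cblinfun_rep cblinfun_linear)
      also have "\<dots> \<le> norm R * (q / (1 - q) * norm x)"
        by (rule order_trans[OF norm_cblinfun_apply]) (intro mult_left_mono N norm_ge_zero)
      finally show "norm ((R o\<^sub>C\<^sub>L N - R) x) \<le> norm R * (q / (1 - q)) * norm x"
        by (simp add: mult.assoc)
    qed (use q in simp)
  qed
qed

lemma resolvent_apply:
  assumes "z \<notin> spectrum A"
  shows resolvent_in_Dom: "resolvent A z y \<in> Dom A"
    and resolvent_right: "z *\<^sub>C resolvent A z y - App A (resolvent A z y) = y"
    and resolvent_left: "x \<in> Dom A \<Longrightarrow> resolvent A z (z *\<^sub>C x - App A x) = x"
  using is_resolvent_resolvent[OF assms] unfolding is_resolvent_def by auto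

lemma resolvent_identity:
  assumes "z \<notin> spectrum A" "w \<notin> spectrum A"
  shows "resolvent A z x - resolvent A w x = (w - z) *\<^sub>C resolvent A z (resolvent A w x)"
proof -
  let ?y = "resolvent A w x"
  have "z *\<^sub>C ?y - App A ?y = (z - w) *\<^sub>C ?y + x"
    using resolvent_right[OF assms(2), of x]
    by (simp add: complex_vector.scale_left_diff_distrib diff_eq_eq eq_diff_eq add_ac)
  then have "(z - w) *\<^sub>C resolvent A z ?y + resolvent A z x = ?y"
    using resolvent_left[OF assms(1) resolvent_in_Dom[OF assms(2)], of x]
    by (simp add: cblinfun_linear)
  then show ?thesis
    by (metis add_diff_cancel_right' complex_vector.scale_minus_left minus_diff_eq)
qed

lemma resolvent_commute:
  assumes "z \<notin> spectrum A" "w \<notin> spectrum A"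
  shows "resolvent A z (resolvent A w x) = resolvent A w (resolvent A z x)"
proof (cases "z = w")
  case False
  have "(w - z) *\<^sub>C resolvent A z (resolvent A w x) = (w - z) *\<^sub>C resolvent A w (resolvent A z x)"
    using resolvent_identity[OF assms, of x] resolvent_identity[OF assms(2,1), of x]
    by (metis complex_vector.scale_minus_left minus_diff_eq)
  then show ?thesis using False by simp
qed simp

lemma resolvent_intertwine:
  assumes z: "z \<notin> spectrum A"
    and \<theta>: "\<And>x. x \<in> Dom A \<Longrightarrow> cblinfun_apply \<theta> x \<in> Dom A \<and> App A (\<theta> x) = \<theta> (App A x)"
  shows "resolvent A z (\<theta> y) = \<theta> (resolvent A z y)"
proof -
  let ?x = "resolvent A z y"
  note x = resolvent_in_Dom[OF z, of y]
  have "\<theta> y = z *\<^sub>C \<theta> ?x - App A (\<theta> ?x)"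
    using \<theta>[OF x] resolvent_right[OF z, of y] by (metis cblinfun_apply_scaleC cblinfun_diff)
  then show ?thesis
    using resolvent_left[OF z, of "\<theta> ?x"] \<theta>[OF x] by simp
qed

section \<open>The resolvent as a holomorphic function\<close>

lemma bounded_bilinear_scaleC:
  "bounded_bilinear (scaleC :: complex \<Rightarrow> 'a \<Rightarrow> 'a :: complex_normed_vector)"
proof
  show "(r *\<^sub>R c) *\<^sub>C x = r *\<^sub>R c *\<^sub>C x" for r c and x :: 'a
    by (metis scaleC_of_real scaleC_scaleC scaleR_conv_of_real)
  show "\<exists>K. \<forall>c (x :: 'a). norm (c *\<^sub>C x) \<le> norm c * norm x * K"
    by (rule exI[of _ 1]) (simp add: norm_scaleC)
qed (simp_all add: scaleC_add_left scaleC_add_right scaleC_scaleR_commute)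

lemmas continuous_on_scaleC = bounded_bilinear.continuous_on[OF bounded_bilinear_scaleC]

lemma scaleR_cblinfun_apply: "cblinfun_apply (r *\<^sub>R F) x = r *\<^sub>R cblinfun_apply F x"
  by (metis scaleC_of_real scaleC_cblinfun.rep_eq)

lemma bounded_linear_apply_cblinfun: "bounded_linear (\<lambda>F. cblinfun_apply F x)"
  by (rule bounded_linear_intro[where K = "norm x"])
     (simp_all add: cblinfun_rep scaleR_cblinfun_apply norm_cblinfun_apply)

text \<open>\<open>contour_integralC\<close> rests on the total function \<open>integral\<close>;
  continuity on the circle guarantees that its value is a true integral and not a default.\<close>

lemma has_integral_contour_integralC:
  fixes F :: "complex \<Rightarrow> 'a :: {complex_normed_vector, banach}"
  assumes F: "continuous_on (path_image (circlepath c r)) F"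
  shows "((\<lambda>t. vector_derivative (circlepath c r) (at t within {0..1}) *\<^sub>C F (circlepath c r t))
    has_integral contour_integralC (circlepath c r) F) {0..1}"
proof -
  let ?\<gamma> = "circlepath c r"
  let ?g = "\<lambda>t. vector_derivative ?\<gamma> (at t within {0..1}) *\<^sub>C F (?\<gamma> t)"
  have "continuous_on {0..1} (\<lambda>t. (2 * pi * \<i> * r * exp (2 * of_real pi * \<i> * t)) *\<^sub>C F (?\<gamma> t))"
  proof (rule continuous_on_scaleC)
    have "continuous_on {0..1} ?\<gamma>"
      by (simp add: continuous_on_path)
    then show "continuous_on {0..1} (\<lambda>t. F (?\<gamma> t))"
      by (rule continuous_on_compose2[OF F]) (simp add: path_image_def)
  qed (intro continuous_intros)
  then have "continuous_on {0..1} ?g"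
    by (rule continuous_on_eq) (simp add: vector_derivative_circlepath01)
  then show ?thesis
    unfolding contour_integralC_def
    by (intro integrable_integral integrable_continuous_real)
qed

text \<open>The bridge to complex analysis: evaluation at \<open>x\<close> followed by
  \<open>\<phi>\<close> is bounded and linear in the operator, so it passes under the integral and
  leaves an ordinary contour integral.\<close>

lemma contour_integralC_circlepath:
  fixes F :: "complex \<Rightarrow> 'a :: complex_normed_vector \<Rightarrow>\<^sub>C\<^sub>L 'b :: {complex_normed_vector, banach}"
    and \<phi> :: "'b \<Rightarrow>\<^sub>C\<^sub>L complex"
  assumes F: "continuous_on (path_image (circlepath c r)) F"
  shows "((\<lambda>z. \<phi> (F z x)) has_contour_integral \<phi> (contour_integralC (circlepath c r) F x))
    (circlepath c r)"
proof -
  have "bounded_linear (\<lambda>F. \<phi> (cblinfun_apply F x))"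
    by (intro bounded_linear_compose[OF bounded_linear_cblinfun_apply] bounded_linear_apply_cblinfun)
  from has_integral_linear[OF has_integral_contour_integralC[OF F] this] show ?thesis
    unfolding has_contour_integral_def
    by (simp add: o_def cblinfun_rep cblinfun_apply_scaleC scaleC_complex_def mult.commute)
qed

lemma norm_contour_integralC_diff:
  fixes F G :: "complex \<Rightarrow> 'a :: {complex_normed_vector, banach}"
  assumes r: "0 < r" and F: "continuous_on (sphere c r) F" and G: "continuous_on (sphere c r) G"
    and b: "\<And>z. z \<in> sphere c r \<Longrightarrow> norm (F z - G z) \<le> b"
  shows "norm (contour_integralC (circlepath c r) F - contour_integralC (circlepath c r) G)
    \<le> 2 * pi * r * b"
proof -
  let ?\<gamma> = "circlepath c r"
  let ?g = "\<lambda>t. vector_derivative ?\<gamma> (at t within {0..1}) *\<^sub>C (F (?\<gamma> t) - G (?\<gamma> t))"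
  have image: "path_image ?\<gamma> = sphere c r" using r by simp
  have "0 \<le> b"
    using order_trans[OF norm_ge_zero b[of "c + of_real r"]] r by (simp add: dist_norm)
  have "(?g has_integral contour_integralC ?\<gamma> F - contour_integralC ?\<gamma> G) {0..1}"
    using has_integral_diff[OF has_integral_contour_integralC[of c r F] has_integral_contour_integralC[of c r G]]
    using F G r by (simp add: complex_vector.scale_right_diff_distrib)
  moreover have "norm (?g t) \<le> 2 * pi * r * b" if t: "t \<in> {0..1} - {}" for t
  proof -
    have "?\<gamma> t \<in> sphere c r" using t by (metis DiffD1 image image_eqI path_image_def)
    then have "norm (F (?\<gamma> t) - G (?\<gamma> t)) \<le> b" by (rule b)
    moreover have "norm (vector_derivative ?\<gamma> (at t within {0..1})) = 2 * pi * r"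
      using r t by (simp add: vector_derivative_circlepath01 norm_mult)
    ultimately show "norm (?g t) \<le> 2 * pi * r * b"
      using r by (simp add: norm_scaleC mult_left_mono)
  qed
  ultimately show ?thesis
    using has_integral_bound_real[of "2 * pi * r * b" "{}" ?g _ 0 1] r \<open>0 \<le> b\<close> by simp
qed

lemma spectrum_perturb:
  fixes A A' :: "'a :: {complex_normed_vector, banach} operator"
  assumes A': "linear_operator A'" and Dom: "Dom A' = Dom A" and z: "z \<notin> spectrum A"
    and q: "0 \<le> q" "q \<le> 1 / 2"
    and bound: "\<And>y. norm (w *\<^sub>C resolvent A z y - App A' (resolvent A z y) - y) \<le> q * norm y"
  shows "w \<notin> spectrum A' \<and> norm (resolvent A' w - resolvent A z) \<le> 2 * q * norm (resolvent A z)"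
proof -
  obtain R' where R': "is_resolvent A' w R'"
    and le: "norm (R' - resolvent A z) \<le> norm (resolvent A z) * (q / (1 - q))"
    by (rule is_resolvent_perturb[OF A' Dom is_resolvent_resolvent[OF z] q(1) _ bound])
       (use q in auto)
  \<comment> \<open>The cap 1/2 on q turns q / (1 - q) into a bound linear in q.\<close>
  have "q * 1 \<le> q * (2 * (1 - q))"
    using q by (intro mult_left_mono) auto
  then have "q / (1 - q) \<le> 2 * q"
    using q by (simp add: divide_le_eq algebra_simps)
  then have "norm (R' - resolvent A z) \<le> norm (resolvent A z) * (2 * q)"
    using le by (meson mult_left_mono norm_ge_zero order_trans)
  then show ?thesis
    using R' by (simp add: not_in_spectrumI resolvent_eqI mult.commute)
qed

text \<open>The second assumption plays the part of the Hahn-Banach theorem: it reduces identities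
  between vectors to identities between complex numbers. It concerns the space only, so a perturbed
  operator inherits it.\<close>

locale separated_operator =
  fixes A :: "'a :: {complex_normed_vector, banach} operator"
  assumes linear: "linear_operator A"
    and separating: "\<And>x :: 'a. (\<And>\<phi> :: 'a \<Rightarrow>\<^sub>C\<^sub>L complex. cblinfun_apply \<phi> x = 0) \<Longrightarrow> x = 0"
begin

lemma eq_by_functionals:
  fixes x y :: 'a
  assumes "\<And>\<phi> :: 'a \<Rightarrow>\<^sub>C\<^sub>L complex. cblinfun_apply \<phi> x = cblinfun_apply \<phi> y"
  shows "x = y"
  using separating[of "x - y"] assms by (simp add: cblinfun_linear)

lemma resolvent_near:
  assumes z: "z \<notin> spectrum A" and \<eta>: "\<eta> > 0"
  shows "\<exists>e>0. \<forall>w. dist w z < e \<longrightarrow> w \<notin> spectrum A \<and> dist (resolvent A w) (resolvent A z) < \<eta>"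
proof -
  \<comment> \<open>The summand 1 keeps M positive even if the resolvent vanishes, as on the zero
    space.\<close>
  define M where "M = norm (resolvent A z) + 1"
  have M: "M > 0" "norm (resolvent A z) \<le> M" by (simp_all add: M_def add_nonneg_pos)
  \<comment> \<open>For dist w z < q / M the residual (w - z) R has norm at most q, and the
    resolvent moves by at most 2 q M \<le> \<eta> / 2.\<close>
  define q where "q = min (1 / 2) (\<eta> / (4 * M))"
  have q: "0 < q" "q \<le> 1 / 2" "q \<le> \<eta> / (4 * M)"
    using \<eta> M by (simp_all add: q_def)
  show ?thesis
  proof (intro exI[of _ "q / M"] conjI allI impI)
    show "q / M > 0" using q M by simp
    fix w assume w: "dist w z < q / M"
    have "norm (w *\<^sub>C resolvent A z y - App A (resolvent A z y) - y) \<le> q * norm y" for y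
    proof -
      have "w *\<^sub>C resolvent A z y - App A (resolvent A z y) - y = (w - z) *\<^sub>C resolvent A z y"
        using resolvent_right[OF z, of y]
        by (simp add: complex_vector.scale_left_diff_distrib diff_eq_eq eq_diff_eq add_ac)
      moreover have "cmod (w - z) * norm (resolvent A z y) \<le> (q / M) * (M * norm y)"
      proof (rule mult_mono)
        show "norm (resolvent A z y) \<le> M * norm y"
          using norm_cblinfun_apply mult_right_mono[OF M(2) norm_ge_zero] by (rule order_trans)
      qed (use w M q in \<open>auto simp: dist_norm\<close>)
      ultimately show ?thesis using M by (simp add: norm_scaleC)
    qed
    from spectrum_perturb[OF linear refl z _ q(2) this]
    have *: "w \<notin> spectrum A" "norm (resolvent A w - resolvent A z) \<le> 2 * q * norm (resolvent A z)"
      using q by auto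
    have "2 * q * norm (resolvent A z) \<le> 2 * (\<eta> / (4 * M)) * M"
      using q M \<eta> by (intro mult_mono) auto
    also have "\<dots> < \<eta>" using M \<eta> by simp
    finally show "w \<notin> spectrum A" "dist (resolvent A w) (resolvent A z) < \<eta>"
      using * by (auto simp: dist_norm)
  qed
qed

lemma closed_spectrum: "closed (spectrum A)"
proof -
  have "open (- spectrum A)"
    unfolding open_dist using resolvent_near[OF _ zero_less_one] by (metis ComplI ComplD)
  then show ?thesis by (simp add: closed_open)
qed

lemma continuous_on_resolvent: "S \<inter> spectrum A = {} \<Longrightarrow> continuous_on S (resolvent A)"
  unfolding continuous_on_iff using resolvent_near by (metis disjoint_iff)

lemma isCont_resolvent: "z \<notin> spectrum A \<Longrightarrow> isCont (resolvent A) z"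
  using continuous_on_resolvent[of "- spectrum A"] closed_spectrum
  by (simp add: continuous_on_eq_continuous_at open_Compl)

text \<open>The resolvent identity turns the difference quotient between w and z into minus the
  functional of the product of both resolvents; continuity of the resolvent then gives the
  limit.\<close>

lemma holomorphic_resolvent:
  fixes \<phi> :: "'a \<Rightarrow>\<^sub>C\<^sub>L complex"
  assumes S: "S \<inter> spectrum A = {}"
  shows "(\<lambda>z. \<phi> (resolvent A z x)) holomorphic_on S"
  unfolding holomorphic_on_def
proof
  fix z assume "z \<in> S"
  with S have z: "z \<notin> spectrum A" by auto
  have "((\<lambda>w. (\<phi> (resolvent A w x) - \<phi> (resolvent A z x)) / (w - z)) \<longlongrightarrow>
      - \<phi> (resolvent A z (resolvent A z x))) (at z)"
  proof (rule Lim_transform_eventually)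
    show "((\<lambda>w. - \<phi> (resolvent A w (resolvent A z x))) \<longlongrightarrow> - \<phi> (resolvent A z (resolvent A z x))) (at z)"
      using isCont_resolvent[OF z] unfolding isCont_def
      by (intro tendsto_minus bounded_linear.tendsto[OF bounded_linear_cblinfun_apply]
          bounded_linear.tendsto[OF bounded_linear_apply_cblinfun])
    have "\<forall>\<^sub>F w in at z. w \<in> - spectrum A"
      using closed_spectrum z by (intro eventually_at_in_open') auto
    then show "\<forall>\<^sub>F w in at z. - \<phi> (resolvent A w (resolvent A z x)) =
        (\<phi> (resolvent A w x) - \<phi> (resolvent A z x)) / (w - z)"
      using eventually_neq_at_within[of z z]
    proof eventually_elim
      case (elim w)
      then have "\<phi> (resolvent A w x) - \<phi> (resolvent A z x) = (z - w) * \<phi> (resolvent A w (resolvent A z x))"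
        using resolvent_identity[of w A z x] z
        by (simp flip: cblinfun_diff add: cblinfun_apply_scaleC scaleC_complex_def)
      then show ?case using elim by (simp add: field_simps)
    qed
  qed
  then show "(\<lambda>z. \<phi> (resolvent A z x)) field_differentiable at z within S"
    unfolding field_differentiable_def has_field_derivative_iff
    using tendsto_within_subset[OF _ subset_UNIV] by blast
qed

end

section \<open>Riesz projectors of discs\<close>

text \<open>The radius is fixed, whereas \<open>eigenprojection\<close> lets it shrink: a
  perturbation may split one eigenvalue into several inside the circle, and the integral over the
  fixed circle is what varies continuously.\<close>

definition riesz_circle ::
  "'a :: complex_normed_vector operator \<Rightarrow> complex \<Rightarrow> real \<Rightarrow> 'a \<Rightarrow>\<^sub>C\<^sub>L 'a" where
  "riesz_circle A c r = (1 / (2 * pi * \<i>)) *\<^sub>C contour_integralC (circlepath c r) (resolvent A)"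

text \<open>The room around a circle gained here separates two circles in
  \<open>riesz_circle_idem\<close> and supplies open domains for the residue theorem.\<close>

lemma exists_larger_disc:
  fixes c :: complex
  assumes K: "closed K" and r: "0 < r" and disj: "sphere c r \<inter> K = {}"
  obtains r' where "r < r'" "\<And>z. r \<le> dist c z \<Longrightarrow> dist c z \<le> r' \<Longrightarrow> z \<notin> K"
proof -
  obtain e where e: "e > 0" "\<And>x y. x \<in> sphere c r \<Longrightarrow> y \<in> K \<Longrightarrow> e \<le> dist x y"
    using separate_compact_closed[OF compact_sphere K disj] by blast
  show thesis
  proof
    show "r < r + e / 2" using e by simp
    fix z assume z: "r \<le> dist c z" "dist c z \<le> r + e / 2"
    \<comment> \<open>The radial projection of z to the circle; it lies at distance dist c z - r
      from z.\<close>
    define p where "p = c + (r / dist c z) *\<^sub>R (z - c)"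
    have "z \<noteq> c" using z r by auto
    then have "p \<in> sphere c r"
      using r by (simp add: p_def dist_norm norm_minus_commute)
    moreover have "dist p z < e"
    proof -
      have "p - z = - ((1 - r / dist c z) *\<^sub>R (z - c))"
        by (simp add: p_def algebra_simps)
      then have "dist p z = \<bar>1 - r / dist c z\<bar> * dist c z"
        by (simp add: dist_norm norm_minus_commute)
      also have "\<dots> = dist c z - r"
        using z r \<open>z \<noteq> c\<close> by (simp add: field_simps)
      finally show ?thesis using z e by simp
    qed
    ultimately show "z \<notin> K" using e(2) by force
  qed
qed

context separated_operator
begin

lemma riesz_circle_integral:
  fixes \<phi> :: "'a \<Rightarrow>\<^sub>C\<^sub>L complex"
  assumes "0 < r" "sphere c r \<inter> spectrum A = {}"
  shows "((\<lambda>z. \<phi> (resolvent A z x)) has_contour_integral 2 * of_real pi * \<i> * \<phi> (riesz_circle A c r x))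
    (circlepath c r)"
proof -
  have "continuous_on (path_image (circlepath c r)) (resolvent A)"
    using assms by (intro continuous_on_resolvent) simp
  from contour_integralC_circlepath[OF this, of \<phi> x] show ?thesis
    by (simp add: riesz_circle_def cblinfun_rep cblinfun_apply_scaleC scaleC_complex_def)
qed

lemma riesz_circle_eqI:
  assumes "0 < r" "sphere c r \<inter> spectrum A = {}"
    and "\<And>(\<phi> :: 'a \<Rightarrow>\<^sub>C\<^sub>L complex) x. ((\<lambda>z. \<phi> (resolvent A z x)) has_contour_integral 2 * of_real pi * \<i> * \<phi> (cblinfun_apply Q x))
      (circlepath c r)"
  shows "riesz_circle A c r = Q"
proof (intro cblinfun_eqI eq_by_functionals)
  fix x and \<phi> :: "'a \<Rightarrow>\<^sub>C\<^sub>L complex"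
  show "\<phi> (riesz_circle A c r x) = \<phi> (Q x)"
    using has_contour_integral_unique[OF riesz_circle_integral[OF assms(1,2)] assms(3)] by simp
qed

text \<open>At each parameter the segment joining the two circles is radial and stays in the
  annulus, so the linear homotopy avoids the spectrum and Cauchy's theorem applies to every scalar
  function.\<close>

lemma riesz_circle_annulus:
  assumes r: "0 < r" "r \<le> r'" and ann: "\<And>z. r \<le> dist c z \<Longrightarrow> dist c z \<le> r' \<Longrightarrow> z \<notin> spectrum A"
  shows "riesz_circle A c r' = riesz_circle A c r"
proof (rule riesz_circle_eqI)
  show s': "sphere c r' \<inter> spectrum A = {}" using ann r by auto
  have s: "sphere c r \<inter> spectrum A = {}" using ann r by auto
  fix \<phi> :: "'a \<Rightarrow>\<^sub>C\<^sub>L complex" and x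
  let ?f = "\<lambda>z. \<phi> (resolvent A z x)"
  have "homotopic_loops (- spectrum A) (circlepath c r) (circlepath c r')"
  proof (rule homotopic_loops_linear)
    fix t :: real
    show "closed_segment (circlepath c r t) (circlepath c r' t) \<subseteq> - spectrum A"
    proof
      fix z assume "z \<in> closed_segment (circlepath c r t) (circlepath c r' t)"
      then obtain u where u: "0 \<le> u" "u \<le> 1"
        and z: "z = (1 - u) *\<^sub>R circlepath c r t + u *\<^sub>R circlepath c r' t"
        unfolding in_segment by blast
      define \<rho> where "\<rho> = (1 - u) * r + u * r'"
      have \<rho>: "r \<le> \<rho>" "\<rho> \<le> r'"
      proof -
        have "u * r \<le> u * r'" "(1 - u) * r \<le> (1 - u) * r'"
          using u r by (auto intro: mult_left_mono)
        then show "r \<le> \<rho>" "\<rho> \<le> r'" by (simp_all add: \<rho>_def algebra_simps)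
      qed
      have "z = circlepath c \<rho> t"
        by (simp add: z \<rho>_def circlepath scaleR_conv_of_real algebra_simps)
      then have "dist c z = \<rho>"
        using r \<rho> by (simp add: circlepath dist_norm norm_mult)
      with ann \<rho> show "z \<in> - spectrum A" by auto
    qed
  qed (simp_all)
  then have "contour_integral (circlepath c r) ?f = contour_integral (circlepath c r') ?f"
    by (rule Cauchy_theorem_homotopic_loops)
       (use closed_spectrum in \<open>auto intro!: holomorphic_resolvent\<close>)
  moreover have "?f contour_integrable_on circlepath c r'"
    using riesz_circle_integral[OF _ s'] r by (auto simp: contour_integrable_on_def)
  ultimately show "(?f has_contour_integral 2 * of_real pi * \<i> * \<phi> (riesz_circle A c r x)) (circlepath c r')"
    using contour_integral_unique[OF riesz_circle_integral[OF r(1) s]]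
    by (metis has_contour_integral_integral)
qed (use r in simp)

text \<open>The partial fraction form of the resolvent identity, integrated over both circles.\<close>

lemma riesz_circle_product:
  assumes r: "0 < r" and s: "sphere c r \<inter> spectrum A = {}"
    and r': "0 < r'" and s': "sphere c' r' \<inter> spectrum A = {}"
    and sep: "sphere c' r' \<inter> cball c r = {}"
    and k: "\<And>z. z \<in> sphere c r \<Longrightarrow>
      ((\<lambda>w. 1 / (w - z)) has_contour_integral 2 * of_real pi * \<i> * k) (circlepath c' r')"
  shows "riesz_circle A c' r' (riesz_circle A c r x) = k *\<^sub>C riesz_circle A c r x"
proof (rule eq_by_functionals)
  fix \<phi> :: "'a \<Rightarrow>\<^sub>C\<^sub>L complex"
  let ?C = "circlepath c r" and ?C' = "circlepath c' r'"
  let ?Q = "riesz_circle A c r" and ?Q' = "riesz_circle A c' r'"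
  let ?f = "\<lambda>z. \<phi> (resolvent A z x)"
  let ?i = "2 * of_real pi * \<i>"
  have sep': "w \<noteq> z" if "w \<in> sphere c' r'" "z \<in> sphere c r" for w z
    using that sep by auto
  \<comment> \<open>The term \<open>?f w / (w - z)\<close> is holomorphic in z on the disc, since w
    lies outside it, and contributes nothing; the resolvent identity merges it with the product of
    resolvents.\<close>
  have inner: "((\<lambda>z. ?f z / (w - z)) has_contour_integral ?i * \<phi> (resolvent A w (?Q x))) ?C"
    if w: "w \<in> sphere c' r'" for w
  proof -
    have "w \<notin> cball c r" using sep w by auto
    then have "((\<lambda>z. 1 / (w - z)) has_contour_integral 0) ?C"
      by (intro Cauchy_theorem_convex_simple[of _ "cball c r"])
         (use r in \<open>auto intro!: holomorphic_intros\<close>)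
    from has_contour_integral_lmul[OF this, of "?f w"]
    have "((\<lambda>z. ?f w / (w - z)) has_contour_integral 0) ?C" by simp
    moreover have "((\<lambda>z. \<phi> (resolvent A w (resolvent A z x))) has_contour_integral
        ?i * \<phi> (resolvent A w (?Q x))) ?C"
      using riesz_circle_integral[OF r s, of "\<phi> o\<^sub>C\<^sub>L resolvent A w" x] by (simp add: cblinfun_rep)
    ultimately have "((\<lambda>z. ?f w / (w - z) + \<phi> (resolvent A w (resolvent A z x))) has_contour_integral
        0 + ?i * \<phi> (resolvent A w (?Q x))) ?C"
      by (rule has_contour_integral_add)
    then show ?thesis
      unfolding add_0
    proof (rule has_contour_integral_eq)
      fix z assume "z \<in> path_image ?C"
      then have z: "z \<in> sphere c r" using r by simp
      have "w \<noteq> z" using sep' w z by blast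
      have "\<phi> (resolvent A w x) - \<phi> (resolvent A z x) = (z - w) * \<phi> (resolvent A w (resolvent A z x))"
      proof -
        have "w \<notin> spectrum A" "z \<notin> spectrum A" using s s' w z by (metis disjoint_iff)+
        from resolvent_identity[OF this, of x] show ?thesis
          by (simp flip: cblinfun_diff add: cblinfun_apply_scaleC scaleC_complex_def)
      qed
      then show "?f w / (w - z) + \<phi> (resolvent A w (resolvent A z x)) = ?f z / (w - z)"
        using \<open>w \<noteq> z\<close> by (simp add: field_simps)
    qed
  qed
  \<comment> \<open>The number k is the winding number of the second circle around z: 1 for nested
    discs, 0 for disjoint ones.\<close>
  have outer: "((\<lambda>w. ?f z / (w - z)) has_contour_integral ?i * k * ?f z) ?C'"
    if "z \<in> sphere c r" for z
    using has_contour_integral_lmul[OF k[OF that], of "?f z"] by (simp add: mult.commute)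
  have "contour_integral ?C' (\<lambda>w. contour_integral ?C (\<lambda>z. ?f z / (w - z)))
      = contour_integral ?C' (\<lambda>w. ?i * \<phi> (resolvent A w (?Q x)))"
    by (rule contour_integral_cong) (use r' in \<open>auto intro!: contour_integral_unique inner\<close>)
  also have "\<dots> = ?i * (?i * \<phi> (?Q' (?Q x)))"
    by (intro contour_integral_unique has_contour_integral_lmul riesz_circle_integral r' s')
  finally have 1: "contour_integral ?C' (\<lambda>w. contour_integral ?C (\<lambda>z. ?f z / (w - z)))
      = ?i * (?i * \<phi> (?Q' (?Q x)))" .
  have "contour_integral ?C (\<lambda>z. contour_integral ?C' (\<lambda>w. ?f z / (w - z)))
      = contour_integral ?C (\<lambda>z. ?i * k * ?f z)"
    by (rule contour_integral_cong) (use r in \<open>auto intro!: contour_integral_unique outer\<close>)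
  also have "\<dots> = ?i * k * (?i * \<phi> (?Q x))"
    by (intro contour_integral_unique has_contour_integral_lmul riesz_circle_integral r s)
  finally have 2: "contour_integral ?C (\<lambda>z. contour_integral ?C' (\<lambda>w. ?f z / (w - z)))
      = ?i * k * (?i * \<phi> (?Q x))" .
  have "continuous_on (sphere c r) ?f"
    using holomorphic_resolvent[OF s] by (rule holomorphic_on_imp_continuous_on)
  then have "continuous_on (sphere c' r' \<times> sphere c r) (\<lambda>p. ?f (snd p) / (fst p - snd p))"
    by (intro continuous_on_divide continuous_on_diff continuous_on_fst continuous_on_snd
        continuous_on_id continuous_on_compose2[of "sphere c r" ?f _ snd]) (use sep' in auto)
  then have "contour_integral ?C' (\<lambda>w. contour_integral ?C (\<lambda>z. ?f z / (w - z))) =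
      contour_integral ?C (\<lambda>z. contour_integral ?C' (\<lambda>w. ?f z / (w - z)))"
    using r r' by (intro contour_integral_swap) (auto simp: split_def vector_derivative_circlepath intro!: continuous_intros)
  with 1 2 have "\<phi> (?Q' (?Q x)) = k * \<phi> (?Q x)" by simp
  then show "\<phi> (?Q' (?Q x)) = \<phi> (k *\<^sub>C ?Q x)"
    by (simp add: cblinfun_apply_scaleC scaleC_complex_def)
qed

lemma riesz_circle_nested:
  assumes r: "0 < r" and s: "sphere c r \<inter> spectrum A = {}"
    and r': "0 < r'" and s': "sphere c' r' \<inter> spectrum A = {}"
    and sub: "cball c r \<subseteq> ball c' r'"
  shows "riesz_circle A c' r' (riesz_circle A c r x) = riesz_circle A c r x"
proof -
  have "riesz_circle A c' r' (riesz_circle A c r x) = 1 *\<^sub>C riesz_circle A c r x"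
  proof (rule riesz_circle_product[OF r s r' s'])
    show "sphere c' r' \<inter> cball c r = {}" using sub by (auto simp: subset_iff)
    fix z assume "z \<in> sphere c r"
    then have "z \<in> ball c' r'" using sub by auto
    then have "((\<lambda>w. 1 / (w - z)) has_contour_integral 2 * of_real pi * \<i> * 1) (circlepath c' r')"
      using Cauchy_integral_circlepath_simple[of "\<lambda>_. 1" c' r' z]
      by (simp add: dist_norm norm_minus_commute)
    then show "((\<lambda>w. 1 / (w - z)) has_contour_integral 2 * of_real pi * \<i> * 1) (circlepath c' r')" .
  qed
  then show ?thesis by (simp add: scaleC_one)
qed

lemma riesz_circle_disjoint:
  assumes r: "0 < r" and s: "sphere c r \<inter> spectrum A = {}"
    and r': "0 < r'" and s': "sphere c' r' \<inter> spectrum A = {}"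
    and disj: "cball c r \<inter> cball c' r' = {}"
  shows "riesz_circle A c' r' (riesz_circle A c r x) = 0"
proof -
  have "riesz_circle A c' r' (riesz_circle A c r x) = 0 *\<^sub>C riesz_circle A c r x"
  proof (rule riesz_circle_product[OF r s r' s'])
    show "sphere c' r' \<inter> cball c r = {}" using disj by auto
    fix z assume "z \<in> sphere c r"
    then have "z \<notin> cball c' r'" using disj by auto
    then have "((\<lambda>w. 1 / (w - z)) has_contour_integral 0) (circlepath c' r')"
      by (intro Cauchy_theorem_convex_simple[of _ "cball c' r'"])
         (use r' in \<open>auto intro!: holomorphic_intros\<close>)
    then show "((\<lambda>w. 1 / (w - z)) has_contour_integral 2 * of_real pi * \<i> * 0) (circlepath c' r')"
      by simp
  qed
  then show ?thesis by (simp add: complex_vector.scale_zero_left)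
qed

text \<open>The product formula requires two circles that do not touch, so one factor is moved to a
  slightly larger circle with the same integral.\<close>

lemma riesz_circle_idem:
  assumes r: "0 < r" and s: "sphere c r \<inter> spectrum A = {}"
  shows "riesz_circle A c r (riesz_circle A c r x) = riesz_circle A c r x"
proof -
  obtain r' where r': "r < r'" "\<And>z. r \<le> dist c z \<Longrightarrow> dist c z \<le> r' \<Longrightarrow> z \<notin> spectrum A"
    using exists_larger_disc[OF closed_spectrum r s] by blast
  have "riesz_circle A c r' = riesz_circle A c r"
    by (rule riesz_circle_annulus) (use r r' in auto)
  moreover have "riesz_circle A c r' (riesz_circle A c r x) = riesz_circle A c r x"
    by (rule riesz_circle_nested[OF r s]) (use r r' in auto)
  ultimately show ?thesis by simp
qed

lemma riesz_circle_commute: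
  assumes r: "0 < r" and s: "sphere c r \<inter> spectrum A = {}"
    and \<theta>: "\<And>z x. z \<in> sphere c r \<Longrightarrow> resolvent A z (cblinfun_apply \<theta> x) = \<theta> (resolvent A z x)"
  shows "riesz_circle A c r (\<theta> x) = \<theta> (riesz_circle A c r x)"
proof (rule eq_by_functionals)
  fix \<phi> :: "'a \<Rightarrow>\<^sub>C\<^sub>L complex"
  have "((\<lambda>z. \<phi> (\<theta> (resolvent A z x))) has_contour_integral 2 * of_real pi * \<i> * \<phi> (\<theta> (riesz_circle A c r x)))
      (circlepath c r)"
    using riesz_circle_integral[OF r s, of "\<phi> o\<^sub>C\<^sub>L \<theta>" x] by (simp add: cblinfun_rep)
  moreover have "((\<lambda>z. \<phi> (\<theta> (resolvent A z x))) has_contour_integral 2 * of_real pi * \<i> * \<phi> (riesz_circle A c r (\<theta> x)))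
      (circlepath c r)"
    by (rule has_contour_integral_eq[OF riesz_circle_integral[OF r s]]) (use r \<theta> in auto)
  ultimately show "\<phi> (riesz_circle A c r (\<theta> x)) = \<phi> (\<theta> (riesz_circle A c r x))"
    using has_contour_integral_unique by fastforce
qed

end

section \<open>Annihilating polynomials\<close>

text \<open>The polynomial p(K) in Horner form, which suits induction over
  \<open>pCons\<close>.\<close>

definition poly_op :: "('a :: complex_normed_vector \<Rightarrow>\<^sub>C\<^sub>L 'a) \<Rightarrow> complex poly \<Rightarrow> 'a \<Rightarrow>\<^sub>C\<^sub>L 'a" where
  "poly_op K p = fold_coeffs (\<lambda>a F. a *\<^sub>C cblinfun_id + K o\<^sub>C\<^sub>L F) p 0"

lemma poly_op_0: "poly_op K 0 x = 0"
  by (simp add: poly_op_def cblinfun_rep)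

lemma poly_op_pCons: "poly_op K (pCons a p) x = a *\<^sub>C x + K (poly_op K p x)"
  by (cases "a = 0 \<and> p = 0")
     (auto simp: poly_op_def cblinfun_rep cblinfun_linear complex_vector.scale_zero_left)

lemma poly_op_add: "poly_op K (p + q) x = poly_op K p x + poly_op K q x"
  by (induction p q rule: poly_induct2)
     (simp_all add: poly_op_0 poly_op_pCons scaleC_add_left cblinfun_linear)

lemma poly_op_smult: "poly_op K (smult c p) x = c *\<^sub>C poly_op K p x"
  by (induction p)
     (simp_all add: poly_op_0 poly_op_pCons cblinfun_linear scaleC_add_right scaleC_scaleC
       complex_vector.scale_zero_right)

lemma poly_op_mult: "poly_op K (p * q) x = poly_op K p (poly_op K q x)"
  by (induction p)
     (simp_all add: poly_op_0 poly_op_pCons poly_op_add poly_op_smult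
       complex_vector.scale_zero_left)

lemma poly_op_sum: "poly_op K (sum f I) x = (\<Sum>i\<in>I. poly_op K (f i) x)"
  by (induction I rule: infinite_finite_induct) (simp_all add: poly_op_0 poly_op_add)

lemma poly_op_monom: "poly_op K (monom c n) x = c *\<^sub>C (cblinfun_apply K ^^ n) x"
  by (induction n)
     (simp_all add: monom_0 monom_Suc poly_op_0 poly_op_pCons cblinfun_linear
       complex_vector.scale_zero_left)

lemma poly_op_commute:
  assumes "\<And>x. cblinfun_apply F (cblinfun_apply K x) = K (F x)"
  shows "F (poly_op K p x) = poly_op K p (F x)"
  by (induction p) (simp_all add: poly_op_0 poly_op_pCons cblinfun_linear assms)

text \<open>The vectors b, K b, K^2 b, ... up to the exponent \<open>card B\<close> are one too many
  to be independent, and a linear relation between them is a polynomial. If two of them coincide,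
  the set of vectors is too small for this count, but a difference of two monomials does the
  job.\<close>

lemma annihilating_poly_vector:
  fixes K :: "'a :: complex_normed_vector \<Rightarrow>\<^sub>C\<^sub>L 'a"
  assumes B: "finite B" and orbit: "\<And>n. (cblinfun_apply K ^^ n) b \<in> cspan B"
  shows "\<exists>p\<noteq>0. poly_op K p b = 0"
proof (cases "inj_on (\<lambda>n. (cblinfun_apply K ^^ n) b) {..card B}")
  case True
  let ?f = "\<lambda>n. (cblinfun_apply K ^^ n) b"
  let ?S = "?f ` {..card B}"
  have "card ?S = Suc (card B)" using True by (simp add: card_image)
  then have "complex_vector.dependent ?S"
    using complex_vector.independent_span_bound[OF B, of ?S] orbit by auto
  then obtain u where u: "\<exists>v\<in>?S. u v \<noteq> 0" "(\<Sum>v\<in>?S. u v *\<^sub>C v) = 0"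
    using complex_vector.dependent_finite[of ?S] by auto
  define p where "p = (\<Sum>n\<le>card B. monom (u (?f n)) n)"
  have "coeff p n = u (?f n)" if "n \<le> card B" for n
    using that by (simp add: p_def coeff_sum)
  then have "p \<noteq> 0" using u(1) by fastforce
  moreover have "poly_op K p b = 0"
    using u(2) True by (simp add: p_def poly_op_sum poly_op_monom sum.reindex)
  ultimately show ?thesis by blast
next
  case False
  then obtain i j where ij: "i \<noteq> j" "(cblinfun_apply K ^^ i) b = (cblinfun_apply K ^^ j) b"
    unfolding inj_on_def by blast
  let ?p = "monom 1 i + monom (-1) j :: complex poly"
  have "coeff ?p i \<noteq> 0" using ij by simp
  then have "?p \<noteq> 0" by (metis coeff_0)
  moreover have "poly_op K ?p b = 0"
    using ij by (simp add: poly_op_add poly_op_monom complex_vector.scale_minus_left)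
  ultimately show ?thesis by blast
qed

text \<open>A spanning set of the range need not lie in the range, where alone the orbits are under
  control. A maximal independent subset of the range replaces it; the product of the annihilators of
  its members kills the range because the factors commute.\<close>

lemma annihilating_poly:
  fixes K Q :: "'a :: complex_normed_vector \<Rightarrow>\<^sub>C\<^sub>L 'a"
  assumes Q: "finite_rank Q" and comm: "\<And>x. K (cblinfun_apply Q x) = Q (K x)"
  shows "\<exists>p\<noteq>0. \<forall>x. poly_op K p (Q x) = 0"
proof -
  obtain B where B: "finite B" "range Q \<subseteq> cspan B"
    using Q unfolding finite_rank_def by blast
  obtain B' where B': "B' \<subseteq> range Q" "complex_vector.independent B'" "range Q \<subseteq> cspan B'"
    using complex_vector.maximal_independent_subset by blast
  have fin: "finite B'"
    using complex_vector.independent_span_bound[OF B(1) B'(2)] B B'(1) by blast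
  have "\<exists>p\<noteq>0. poly_op K p b = 0" if b: "b \<in> B'" for b
  proof (rule annihilating_poly_vector[OF B(1)])
    obtain y where "b = Q y" using b B' by blast
    then have "(cblinfun_apply K ^^ n) b = Q ((cblinfun_apply K ^^ n) y)" for n
      by (induction n) (simp_all add: comm)
    then show "(cblinfun_apply K ^^ n) b \<in> cspan B" for n
      using B by auto
  qed
  then obtain P where P: "\<And>b. b \<in> B' \<Longrightarrow> P b \<noteq> 0" "\<And>b. b \<in> B' \<Longrightarrow> poly_op K (P b) b = 0"
    by metis
  define p where "p = (\<Prod>b\<in>B'. P b)"
  have "p \<noteq> 0" using P fin by (simp add: p_def)
  moreover have ann: "poly_op K p b = 0" if b: "b \<in> B'" for b
  proof -
    have "p = prod P (B' - {b}) * P b"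
      using prod.remove[OF fin b, of P] by (simp add: p_def mult.commute)
    then show ?thesis using P(2)[OF b] by (simp add: poly_op_mult cblinfun_linear)
  qed
  moreover have "poly_op K p v = 0" if "v \<in> cspan B'" for v
    using that
  proof (induction rule: complex_vector.span_induct_alt)
    case (step c x y)
    then show ?case by (simp add: cblinfun_linear ann complex_vector.scale_zero_right)
  qed (simp add: cblinfun_linear)
  ultimately show ?thesis using B' by blast
qed

text \<open>The finite exceptional set consists of the roots of an annihilating polynomial of minimal
  degree.\<close>

lemma finite_rank_dichotomy:
  fixes K Q :: "'a :: complex_normed_vector \<Rightarrow>\<^sub>C\<^sub>L 'a"
  assumes Q: "finite_rank Q" and comm: "\<And>x. K (cblinfun_apply Q x) = Q (K x)"
  obtains N where "finite N"
    "\<And>\<nu>. \<nu> \<in> N \<Longrightarrow> \<exists>v. v \<noteq> 0 \<and> K v = \<nu> *\<^sub>C v"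
    "\<And>\<nu>. \<nu> \<notin> N \<Longrightarrow> \<exists>S :: 'a \<Rightarrow>\<^sub>C\<^sub>L 'a. (\<forall>x. S (K x) = K (S x)) \<and>
       (\<forall>x. \<nu> *\<^sub>C S (Q x) - K (S (Q x)) = Q x)"
proof -
  define good where "good p \<longleftrightarrow> p \<noteq> 0 \<and> (\<forall>x. poly_op K p (Q x) = 0)" for p
  obtain p where p: "good p" and min: "\<And>q. good q \<Longrightarrow> degree p \<le> degree q"
    using annihilating_poly[OF assms] ex_has_least_nat[of good _ degree]
    unfolding good_def by blast
  show thesis
  proof
    show "finite {\<nu>. poly p \<nu> = 0}"
      using p by (simp add: good_def poly_roots_finite)
    fix \<nu>
    let ?q = "synthetic_div p \<nu>"
    \<comment> \<open>Division by X - \<nu> with remainder p(\<nu>); at K it reads p(K) = (K -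
      \<nu>) q(K) + p(\<nu>).\<close>
    have div: "[:-\<nu>, 1:] * ?q + [:poly p \<nu>:] = p"
      by (rule synthetic_div_correct')
    have "poly_op K p y = poly_op K ([:-\<nu>, 1:] * ?q + [:poly p \<nu>:]) y" for y
      by (simp only: div)
    then have eq: "poly_op K p y = K (poly_op K ?q y) - \<nu> *\<^sub>C poly_op K ?q y + poly p \<nu> *\<^sub>C y" for y
      unfolding poly_op_add poly_op_mult
      by (simp add: poly_op_pCons poly_op_0 cblinfun_linear complex_vector.scale_minus_left scaleC_one)
    show "\<exists>v. v \<noteq> 0 \<and> K v = \<nu> *\<^sub>C v" if root: "\<nu> \<in> {\<nu>. poly p \<nu> = 0}"
    proof -
      have "p \<noteq> 0" using p by (simp add: good_def)
      have "?q \<noteq> 0" using div root \<open>p \<noteq> 0\<close> by auto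
      moreover have "p = [:-\<nu>, 1:] * ?q" using div root by simp
      ultimately have "degree p = Suc (degree ?q)"
        using degree_mult_eq[of "[:-\<nu>, 1:]" ?q] by simp
      \<comment> \<open>By minimality q(K) does not kill the range of Q, while (K - \<nu>) q(K) =
        p(K) does; hence a nonzero value of q(K) on the range is an eigenvector.\<close>
      then have "\<not> good ?q" using min[of ?q] by auto
      then obtain x where "poly_op K ?q (Q x) \<noteq> 0"
        using \<open>?q \<noteq> 0\<close> unfolding good_def by blast
      moreover have "K (poly_op K ?q (Q x)) = \<nu> *\<^sub>C poly_op K ?q (Q x)"
        using eq[of "Q x"] p root by (simp add: good_def complex_vector.scale_zero_left)
      ultimately show ?thesis by blast
    qed
    show "\<exists>S :: 'a \<Rightarrow>\<^sub>C\<^sub>L 'a. (\<forall>x. S (K x) = K (S x)) \<and> (\<forall>x. \<nu> *\<^sub>C S (Q x) - K (S (Q x)) = Q x)"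
      if "\<nu> \<notin> {\<nu>. poly p \<nu> = 0}"
    proof (intro exI conjI allI)
      \<comment> \<open>On the range of Q the relation p(K) = 0 becomes (\<nu> - K) q(K) = p(\<nu>),
        so q(K) / p(\<nu>) inverts \<nu> - K there and commutes with K.\<close>
      let ?S = "(1 / poly p \<nu>) *\<^sub>C poly_op K ?q"
      fix x
      show "?S (K x) = K (?S x)"
        by (simp add: cblinfun_rep cblinfun_linear poly_op_commute)
      have "poly p \<nu> *\<^sub>C Q x = \<nu> *\<^sub>C poly_op K ?q (Q x) - K (poly_op K ?q (Q x))"
        using eq[of "Q x"] p unfolding good_def by (metis add_eq_0_iff minus_diff_eq)
      then have "(1 / poly p \<nu>) *\<^sub>C poly p \<nu> *\<^sub>C Q x =
          (1 / poly p \<nu>) *\<^sub>C (\<nu> *\<^sub>C poly_op K ?q (Q x) - K (poly_op K ?q (Q x)))"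
        by simp
      then show "\<nu> *\<^sub>C ?S (Q x) - K (?S (Q x)) = Q x"
        using that
        by (simp add: cblinfun_rep cblinfun_linear scaleC_scaleC scaleC_one
            complex_vector.scale_right_diff_distrib mult.commute)
    qed
  qed
qed

section \<open>The spectrum inside a disc\<close>

context separated_operator
begin

text \<open>With \<open>w\<close> on the circle, \<open>T z\<close> inverts \<open>z - A\<close> on the kernel of the disc projector,
  while on its finite-dimensional range \<open>z - A\<close> is governed by \<open>K = (w - A)\<^sup>-\<^sup>1\<close>, whose
  spectral parameter is \<open>\<nu> = 1 / (w - z)\<close>.\<close>

lemma disc_complement_inverse:
  assumes r: "0 < r" and s: "sphere c r \<inter> spectrum A = {}" and w: "w \<in> sphere c r" and z: "z \<in> ball c r"
  obtains T :: "'a \<Rightarrow>\<^sub>C\<^sub>L 'a" where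
    "\<And>x. T x + (z - w) *\<^sub>C resolvent A w (T x) = resolvent A w (x - riesz_circle A c r x)"
    "\<And>x. T (resolvent A w x) = resolvent A w (T x)"
proof
  let ?C = "circlepath c r" and ?Q = "riesz_circle A c r" and ?R = "resolvent A w"
  let ?i = "2 * of_real pi * \<i>"
  have nz: "v \<noteq> z" if "v \<in> sphere c r" for v using that z by auto
  have in_s: "v \<notin> spectrum A" if "v \<in> sphere c r" for v using that s by auto
  \<comment> \<open>Integrating (z - A) (v - A)^-1 / (v - z) = 1 / (v - z) - (v - A)^-1 over v gives
    (z - A) T = 1 - Q. The claim is this equation multiplied by the resolvent at w, since 1 + (z -
    w) (w - A)^-1 = (w - A)^-1 (z - A); in this form only bounded operators pass under the
    integral.\<close>
  define T where
    "T = (1 / ?i) *\<^sub>C contour_integralC ?C (\<lambda>v. (1 / (v - z)) *\<^sub>C resolvent A v)"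
  have T: "((\<lambda>v. \<phi> (resolvent A v x) / (v - z)) has_contour_integral ?i * \<phi> (T x)) ?C"
    for \<phi> :: "'a \<Rightarrow>\<^sub>C\<^sub>L complex" and x
  proof -
    have "continuous_on (path_image ?C) (\<lambda>v. (1 / (v - z)) *\<^sub>C resolvent A v)"
    proof (rule continuous_on_scaleC)
      show "continuous_on (path_image ?C) (\<lambda>v. 1 / (v - z))"
        using r nz by (intro continuous_on_divide continuous_on_diff continuous_on_const continuous_on_id) auto
      show "continuous_on (path_image ?C) (resolvent A)"
        using r s by (intro continuous_on_resolvent) simp
    qed
    from contour_integralC_circlepath[OF this, of \<phi> x] show ?thesis
      by (simp add: T_def cblinfun_rep cblinfun_apply_scaleC scaleC_complex_def)
  qed
  \<comment> \<open>The pointwise form of that equation, with a for the resolvent at w and b for the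
    product of the resolvents at w and v.\<close>
  have part: "(a + (w - v) * b) / (v - z) + (z - w) * (b / (v - z)) + b = a / (v - z)" if "v \<noteq> z" for a b v
  proof -
    have "b = (v - z) * b / (v - z)" using that by simp
    then have "(a + (w - v) * b) / (v - z) + (z - w) * (b / (v - z)) + b
        = ((a + (w - v) * b) + (z - w) * b + (v - z) * b) / (v - z)"
      by (simp add: add_divide_distrib)
    then show ?thesis by (simp add: algebra_simps)
  qed
  show "T x + (z - w) *\<^sub>C ?R (T x) = ?R (x - ?Q x)" for x
  proof (rule eq_by_functionals)
    fix \<phi> :: "'a \<Rightarrow>\<^sub>C\<^sub>L complex"
    have "((\<lambda>v. \<phi> (resolvent A v x) / (v - z) + (z - w) * (\<phi> (?R (resolvent A v x)) / (v - z))
        + \<phi> (?R (resolvent A v x))) has_contour_integral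
        ?i * \<phi> (T x) + (z - w) * (?i * \<phi> (?R (T x))) + ?i * \<phi> (?R (?Q x))) ?C"
      using T[of "\<phi> o\<^sub>C\<^sub>L ?R" x] riesz_circle_integral[OF r s, of "\<phi> o\<^sub>C\<^sub>L ?R" x]
      by (intro has_contour_integral_add has_contour_integral_lmul T) (simp_all add: cblinfun_rep)
    then have "((\<lambda>v. \<phi> (?R x) / (v - z)) has_contour_integral
        ?i * \<phi> (T x) + (z - w) * (?i * \<phi> (?R (T x))) + ?i * \<phi> (?R (?Q x))) ?C"
    proof (rule has_contour_integral_eq)
      fix v assume "v \<in> path_image ?C"
      then have v: "v \<in> sphere c r" using r by simp
      have "\<phi> (resolvent A v x - ?R x) = (w - v) * \<phi> (?R (resolvent A v x))"
        using resolvent_identity[OF in_s[OF v] in_s[OF w], of x] resolvent_commute[OF in_s[OF v] in_s[OF w], of x]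
        by (simp add: cblinfun_apply_scaleC scaleC_complex_def)
      then have *: "\<phi> (resolvent A v x) = \<phi> (?R x) + (w - v) * \<phi> (?R (resolvent A v x))"
        by (simp add: cblinfun_diff diff_eq_eq)
      show "\<phi> (resolvent A v x) / (v - z) + (z - w) * (\<phi> (?R (resolvent A v x)) / (v - z))
          + \<phi> (?R (resolvent A v x)) = \<phi> (?R x) / (v - z)"
        using part[of v] nz[OF v] unfolding * by simp
    qed
    moreover have "((\<lambda>v. \<phi> (?R x) / (v - z)) has_contour_integral ?i * \<phi> (?R x)) ?C"
      using Cauchy_integral_circlepath_simple[of "\<lambda>_. \<phi> (?R x)" c r z] z
      by (simp add: dist_norm norm_minus_commute)
    ultimately have "?i * \<phi> (T x) + (z - w) * (?i * \<phi> (?R (T x))) + ?i * \<phi> (?R (?Q x)) = ?i * \<phi> (?R x)"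
      using has_contour_integral_unique by blast
    then have "?i * (\<phi> (T x) + (z - w) * \<phi> (?R (T x)) + \<phi> (?R (?Q x))) = ?i * \<phi> (?R x)"
      by (simp add: algebra_simps)
    then have "\<phi> (T x) + (z - w) * \<phi> (?R (T x)) + \<phi> (?R (?Q x)) = \<phi> (?R x)"
      by (subst (asm) mult_cancel_left) simp
    then show "\<phi> (T x + (z - w) *\<^sub>C ?R (T x)) = \<phi> (?R (x - ?Q x))"
      by (simp add: cblinfun_linear scaleC_complex_def eq_diff_eq)
  qed
  show "T (?R x) = ?R (T x)" for x
  proof (rule eq_by_functionals)
    fix \<phi> :: "'a \<Rightarrow>\<^sub>C\<^sub>L complex"
    have "((\<lambda>v. \<phi> (?R (resolvent A v x)) / (v - z)) has_contour_integral ?i * \<phi> (?R (T x))) ?C"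
      using T[of "\<phi> o\<^sub>C\<^sub>L ?R" x] by (simp add: cblinfun_rep)
    moreover have "((\<lambda>v. \<phi> (?R (resolvent A v x)) / (v - z)) has_contour_integral ?i * \<phi> (T (?R x))) ?C"
      by (rule has_contour_integral_eq[OF T])
         (use r in_s w in \<open>simp add: resolvent_commute\<close>)
    ultimately have "?i * \<phi> (?R (T x)) = ?i * \<phi> (T (?R x))"
      by (rule has_contour_integral_unique)
    then show "\<phi> (T (?R x)) = \<phi> (?R (T x))" by simp
  qed
qed

text \<open>If \<nu> = 1 / (w - z) avoids the finite exceptional set of K, the inverses of z - A on
  the kernel and on the range of the projector add up to a bounded resolvent. Otherwise \<nu> is an
  eigenvalue of K, which makes z an eigenvalue of A.\<close>

lemma disc_spectrum:
  assumes r: "0 < r" and s: "sphere c r \<inter> spectrum A = {}"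
    and fin: "finite_rank (riesz_circle A c r)"
  shows finite_disc_spectrum: "finite (spectrum A \<inter> ball c r)"
    and eigenvalue_disc_spectrum: "z \<in> spectrum A \<inter> ball c r \<Longrightarrow> eigenvalue A z"
proof -
  let ?Q = "riesz_circle A c r"
  define w where "w = c + of_real r"
  have w: "w \<in> sphere c r" using r by (simp add: w_def dist_norm)
  then have wA: "w \<notin> spectrum A" using s by auto
  let ?K = "resolvent A w"
  have KQ: "?K (?Q x) = ?Q (?K x)" for x
    by (rule riesz_circle_commute[OF r s, symmetric], rule resolvent_commute)
       (use s wA in auto)
  obtain N where N: "finite N"
    "\<And>\<nu>. \<nu> \<in> N \<Longrightarrow> \<exists>v. v \<noteq> 0 \<and> ?K v = \<nu> *\<^sub>C v"
    "\<And>\<nu>. \<nu> \<notin> N \<Longrightarrow> \<exists>S :: 'a \<Rightarrow>\<^sub>C\<^sub>L 'a. (\<forall>x. S (?K x) = ?K (S x)) \<and>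
       (\<forall>x. \<nu> *\<^sub>C S (?Q x) - ?K (S (?Q x)) = ?Q x)"
    using finite_rank_dichotomy[OF fin KQ] by blast
  have in_N: "1 / (w - z) \<in> N" if z: "z \<in> spectrum A \<inter> ball c r" for z
  proof (rule ccontr)
    define \<nu> where "\<nu> = 1 / (w - z)"
    have wz: "w \<noteq> z" using z w by auto
    assume "1 / (w - z) \<notin> N"
    then obtain S :: "'a \<Rightarrow>\<^sub>C\<^sub>L 'a" where S: "\<And>x. S (?K x) = ?K (S x)"
      "\<And>x. \<nu> *\<^sub>C S (?Q x) = ?Q x + ?K (S (?Q x))"
      using N(3)[of \<nu>] by (auto simp: \<nu>_def diff_eq_eq)
    obtain T :: "'a \<Rightarrow>\<^sub>C\<^sub>L 'a" where T:
      "\<And>x. T x + (z - w) *\<^sub>C ?K (T x) = ?K (x - ?Q x)"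
      "\<And>x. T (?K x) = ?K (T x)"
      using disc_complement_inverse[OF r s w, of z] z by blast
    \<comment> \<open>On the range, z - A = (w - A) (1 - (w - z) K) has the inverse \<nu> K (\<nu> -
      K)^-1, and S stands for (\<nu> - K)^-1 there.\<close>
    define R where "R = T + \<nu> *\<^sub>C (?K o\<^sub>C\<^sub>L S o\<^sub>C\<^sub>L ?Q)"
    have R: "R x = T x + \<nu> *\<^sub>C ?K (S (?Q x))" for x
      by (simp add: R_def cblinfun_rep)
    have \<nu>: "(z - w) * \<nu> = -1"
      using wz by (simp add: \<nu>_def field_simps)
    have zw: "((z - w) * \<nu>) *\<^sub>C x = - x" for x :: 'a
      unfolding \<nu> by (simp add: complex_vector.scale_minus_left scaleC_one)
    have "is_resolvent A z R"
      unfolding is_resolvent_def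
    proof (intro conjI allI ballI)
      fix y
      \<comment> \<open>Chosen so that \<open>R y = ?K g\<close>: this puts \<open>R y\<close> into
        the domain and gives (w - A) applied to \<open>R y\<close> as g.\<close>
      define g where "g = y - ?Q y - (z - w) *\<^sub>C T y + \<nu> *\<^sub>C S (?Q y)"
      have "R y = ?K g"
        using T(1)[of y] by (simp add: R g_def cblinfun_linear algebra_simps T(2))
      moreover have "(z - w) *\<^sub>C R y = (z - w) *\<^sub>C T y - ?K (S (?Q y))"
        by (simp add: R scaleC_add_right zw)
      moreover have "w *\<^sub>C ?K g - App A (?K g) = g"
        by (rule resolvent_right[OF wA])
      ultimately show "z *\<^sub>C R y - App A (R y) = y" "R y \<in> Dom A"
        using S(2)[of y] resolvent_in_Dom[OF wA, of g]
        by (simp_all add: g_def complex_vector.scale_left_diff_distrib algebra_simps)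
    next
      fix x assume x: "x \<in> Dom A"
      \<comment> \<open>Writing x as \<open>?K y\<close> turns the left inverse property into an
        identity between bounded operators.\<close>
      define y where "y = w *\<^sub>C x - App A x"
      have xy: "x = ?K y"
        using resolvent_left[OF wA x] by (simp add: y_def)
      have h: "z *\<^sub>C x - App A x = (z - w) *\<^sub>C ?K y + y"
        unfolding xy[symmetric] by (simp add: y_def complex_vector.scale_left_diff_distrib)
      have "T ((z - w) *\<^sub>C ?K y + y) = ?K (y - ?Q y)"
        using T(1)[of y] by (simp add: cblinfun_linear T(2) add.commute)
      moreover have "\<nu> *\<^sub>C ?K (S (?Q ((z - w) *\<^sub>C ?K y + y))) = ?K (?Q y)"
      proof -
        have "\<nu> *\<^sub>C ?K (S (?Q ((z - w) *\<^sub>C ?K y + y)))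
            = (z - w) *\<^sub>C \<nu> *\<^sub>C ?K (?K (S (?Q y))) + ?K (\<nu> *\<^sub>C S (?Q y))"
          by (simp add: cblinfun_linear scaleC_add_right scaleC_scaleC mult.commute KQ[symmetric] S(1))
        then show ?thesis by (simp add: zw S(2) cblinfun_linear)
      qed
      ultimately show "R (z *\<^sub>C x - App A x) = x"
        unfolding h R by (simp add: cblinfun_linear xy[symmetric])
    qed
    then show False using z not_in_spectrumI by blast
  qed
  \<comment> \<open>The point z is recovered from \<nu> = 1 / (w - z), so finiteness of N passes to
    the spectrum.\<close>
  have "spectrum A \<inter> ball c r \<subseteq> (\<lambda>\<nu>. w - 1 / \<nu>) ` N"
    using in_N by (force simp: image_iff)
  then show "finite (spectrum A \<inter> ball c r)"
    using N(1) finite_surj by blast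
  assume z: "z \<in> spectrum A \<inter> ball c r"
  then have wz: "w \<noteq> z" using w by auto
  obtain v where v: "v \<noteq> 0" "?K v = (1 / (w - z)) *\<^sub>C v"
    using N(2) in_N[OF z] by blast
  \<comment> \<open>This multiple of v lies in the domain of A; comparing (w - A) u = v with (w - z)
    u = v yields A u = z u.\<close>
  let ?u = "?K v"
  have "(w - z) *\<^sub>C ?u = v"
    using wz by (simp add: v(2) scaleC_scaleC scaleC_one)
  then have "App A ?u = z *\<^sub>C ?u"
    using resolvent_right[OF wA, of v]
    by (simp add: complex_vector.scale_left_diff_distrib) (metis add_diff_cancel_left' diff_add_cancel diff_eq_eq)
  moreover have "?u \<noteq> 0"
    using \<open>(w - z) *\<^sub>C ?u = v\<close> v(1) by (metis complex_vector.scale_zero_right)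
  ultimately show "eigenvalue A z"
    unfolding eigenvalue_def using resolvent_in_Dom[OF wA] by blast
qed

section \<open>Disc projectors as sums of eigenprojections\<close>

lemma riesz_circle_eq_eigenprojection:
  assumes r: "0 < r" and sub: "cball \<mu> r \<inter> spectrum A \<subseteq> {\<mu>}"
  shows "riesz_circle A \<mu> r = eigenprojection A \<mu>"
proof -
  have eq: "riesz_circle A \<mu> r = riesz_circle A \<mu> r'" if "0 < r'" "r' \<le> r" for r'
    by (rule riesz_circle_annulus) (use that sub in auto)
  have "\<forall>\<^sub>F r' in at_right 0. riesz_circle A \<mu> r' = riesz_circle A \<mu> r"
    using eventually_at_right_real[OF r]
  proof eventually_elim
    case (elim r')
    then show ?case using eq[of r'] by simp
  qed
  \<comment> \<open>The filter of right neighbourhoods of 0 is nontrivial, so two eventual values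
    agree at some common radius.\<close>
  moreover from this have "P = riesz_circle A \<mu> r"
    if "\<forall>\<^sub>F r' in at_right 0. riesz_circle A \<mu> r' = P" for P
    using eventually_happens[OF eventually_conj[OF that]] by (auto simp: trivial_limit_at_right_real)
  ultimately have "(THE P. \<forall>\<^sub>F r in at_right 0. riesz_circle A \<mu> r = P) = riesz_circle A \<mu> r"
    by (rule the_equality)
  then show ?thesis
    by (simp add: eigenprojection_def riesz_circle_def)
qed

lemma isolated_disc:
  assumes "\<mu> isolated_in spectrum A" "open U" "\<mu> \<in> U"
  obtains e where "0 < e" "cball \<mu> e \<subseteq> U" "cball \<mu> e \<inter> spectrum A = {\<mu>}" "sphere \<mu> e \<inter> spectrum A = {}"
proof -
  obtain V where V: "open V" "V \<inter> spectrum A = {\<mu>}"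
    using assms(1) unfolding isolated_in_def by blast
  then obtain e where "0 < e" "cball \<mu> e \<subseteq> U \<inter> V"
    using open_contains_cball[of "U \<inter> V"] assms by blast
  moreover from this have "cball \<mu> e \<inter> spectrum A = {\<mu>}"
    using V assms(1) by (auto simp: isolated_in_def)
  moreover from this \<open>0 < e\<close> have "sphere \<mu> e \<inter> spectrum A = {}"
    by (force simp: set_eq_iff)
  ultimately show thesis using that by blast
qed

lemma isolated_in_finite:
  assumes "finite (spectrum A \<inter> U)" "open U" "\<mu> \<in> spectrum A \<inter> U"
  shows "\<mu> isolated_in spectrum A"
  unfolding isolated_in_islimpt_iff islimpt_eq_acc_point
  using assms by (metis Int_commute IntE)

text \<open>For each scalar function the residue at \<mu> is the functional applied to the
  eigenprojection of \<mu>, and every winding number is 1, so the residue theorem gives the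
  sum.\<close>

lemma riesz_circle_eq_sum:
  assumes r: "0 < r" and s: "sphere c r \<inter> spectrum A = {}"
    and fin: "finite (spectrum A \<inter> ball c r)"
  shows "riesz_circle A c r = (\<Sum>\<mu>\<in>spectrum A \<inter> ball c r. eigenprojection A \<mu>)"
proof (rule riesz_circle_eqI[OF r s])
  fix \<phi> :: "'a \<Rightarrow>\<^sub>C\<^sub>L complex" and x
  let ?f = "\<lambda>z. \<phi> (resolvent A z x)" and ?C = "circlepath c r"
  let ?P = "spectrum A \<inter> ball c r"
  obtain r' where r': "r < r'" "\<And>z. r \<le> dist c z \<Longrightarrow> dist c z \<le> r' \<Longrightarrow> z \<notin> spectrum A"
    using exists_larger_disc[OF closed_spectrum r s] by blast
  have res: "residue ?f \<mu> = \<phi> (eigenprojection A \<mu> x)" if \<mu>: "\<mu> \<in> ?P" for \<mu>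
  proof -
    have "\<mu> isolated_in spectrum A"
      by (rule isolated_in_finite[OF fin _ \<mu>]) simp
    then obtain e where e: "0 < e" "cball \<mu> e \<subseteq> ball c r" "cball \<mu> e \<inter> spectrum A = {\<mu>}" "sphere \<mu> e \<inter> spectrum A = {}"
      using isolated_disc[of \<mu> "ball c r"] \<mu> by auto
    obtain e' where e': "e < e'" "\<And>z. e \<le> dist \<mu> z \<Longrightarrow> dist \<mu> z \<le> e' \<Longrightarrow> z \<notin> spectrum A"
      using exists_larger_disc[OF closed_spectrum e(1,4)] by blast
    have "(?f has_contour_integral 2 * pi * \<i> * residue ?f \<mu>) (circlepath \<mu> e)"
    proof (rule base_residue)
      show "?f holomorphic_on ball \<mu> e' - {\<mu>}"
      proof (rule holomorphic_resolvent)
        show "(ball \<mu> e' - {\<mu>}) \<inter> spectrum A = {}"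
          using e(3) e'(2) by (force simp: not_le)
      qed
    qed (use e e' in auto)
    moreover have "(?f has_contour_integral 2 * of_real pi * \<i> * \<phi> (eigenprojection A \<mu> x)) (circlepath \<mu> e)"
      using riesz_circle_integral[of e \<mu> \<phi> x] e riesz_circle_eq_eigenprojection[of e \<mu>] by auto
    ultimately show ?thesis
      using has_contour_integral_unique by fastforce
  qed
  have "contour_integral ?C ?f = 2 * pi * \<i> * (\<Sum>\<mu>\<in>?P. winding_number ?C \<mu> * residue ?f \<mu>)"
  proof (rule Residue_theorem[of "ball c r'"])
    show "?f holomorphic_on ball c r' - ?P"
    proof (rule holomorphic_resolvent)
      show "(ball c r' - ?P) \<inter> spectrum A = {}" using r' by (force simp: not_le)
    qed
    show "\<forall>z. z \<notin> ball c r' \<longrightarrow> winding_number ?C z = 0"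
      using r r' by (auto intro!: winding_number_zero_outside[of _ "cball c r"])
  qed (use r r' fin in auto)
  also have "\<dots> = 2 * of_real pi * \<i> * \<phi> ((\<Sum>\<mu>\<in>?P. eigenprojection A \<mu>) x)"
    by (auto simp: sum_cblinfun_apply cblinfun_sum res dist_norm norm_minus_commute
        winding_number_circlepath intro!: sum.cong)
  finally show "(?f has_contour_integral 2 * of_real pi * \<i> * \<phi> ((\<Sum>\<mu>\<in>?P. eigenprojection A \<mu>) x)) ?C"
    using riesz_circle_integral[OF r s, of \<phi> x] contour_integral_unique by metis
qed

text \<open>The projector of the large disc fixes that of a small disc around \<mu>, so the
  eigenprojection has its range inside a finite-dimensional one.\<close>

lemma discrete_eigenvalue_disc:
  assumes r: "0 < r" and s: "sphere c r \<inter> spectrum A = {}"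
    and fin: "finite_rank (riesz_circle A c r)" and \<mu>: "\<mu> \<in> spectrum A \<inter> ball c r"
  shows "discrete_eigenvalue A \<mu>"
proof -
  have iso: "\<mu> isolated_in spectrum A"
    by (rule isolated_in_finite[OF finite_disc_spectrum[OF r s fin] _ \<mu>]) simp
  then obtain e where e: "0 < e" "cball \<mu> e \<subseteq> ball c r" "cball \<mu> e \<inter> spectrum A = {\<mu>}" "sphere \<mu> e \<inter> spectrum A = {}"
    using isolated_disc[of \<mu> "ball c r"] \<mu> by auto
  have "riesz_circle A \<mu> e x = riesz_circle A c r (riesz_circle A \<mu> e x)" for x
    by (rule riesz_circle_nested[symmetric]) (use e r s in auto)
  then have "range (riesz_circle A \<mu> e) \<subseteq> range (riesz_circle A c r)"
    by (metis image_subsetI rangeI)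
  moreover have "riesz_circle A \<mu> e = eigenprojection A \<mu>"
    by (rule riesz_circle_eq_eigenprojection) (use e in auto)
  ultimately have "finite_rank (eigenprojection A \<mu>)"
    using fin unfolding finite_rank_def by (metis subset_trans)
  then show ?thesis
    using iso eigenvalue_disc_spectrum[OF r s fin \<mu>] by (simp add: discrete_eigenvalue_def)
qed

end

section \<open>Similar projectors\<close>

text \<open>For W = Q P + (1 - Q) (1 - P) the defect 1 - W = Q + P - 2 Q P equals Q (Q - P) - (Q -
  P) P. This explains the smallness hypothesis and lets the Neumann inverse apply.\<close>

lemma similar_projections:
  fixes P Q :: "'a :: {complex_normed_vector, banach} \<Rightarrow>\<^sub>C\<^sub>L 'a"
  assumes P: "\<And>x. P (cblinfun_apply P x) = P x" and Q: "\<And>x. Q (cblinfun_apply Q x) = Q x"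
    and close: "norm (Q - P) * (norm P + norm Q) < 1"
  shows "\<exists>(W :: 'a \<Rightarrow>\<^sub>C\<^sub>L 'a) (W' :: 'a \<Rightarrow>\<^sub>C\<^sub>L 'a). (\<forall>x. W (W' x) = x) \<and> (\<forall>x. W' (W x) = x) \<and> (\<forall>x. Q (W x) = W (P x)) \<and>
    (\<forall>\<theta> :: 'a \<Rightarrow>\<^sub>C\<^sub>L 'a. (\<forall>x. P (\<theta> x) = \<theta> (P x) \<and> Q (\<theta> x) = \<theta> (Q x)) \<longrightarrow> (\<forall>x. W (\<theta> x) = \<theta> (W x)))"
proof -
  define W where "W = Q o\<^sub>C\<^sub>L P + (cblinfun_id - Q) o\<^sub>C\<^sub>L (cblinfun_id - P)"
  have W: "W x = Q (P x) + (x - P x - (Q x - Q (P x)))" for x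
    by (simp add: W_def cblinfun_rep cblinfun_linear)
  define S where "S = cblinfun_id - W"
  have S: "S x = x - W x" for x by (simp add: S_def cblinfun_rep)
  have bound: "norm (S x) \<le> norm (Q - P) * (norm P + norm Q) * norm x" for x
  proof -
    have "S = Q o\<^sub>C\<^sub>L (Q - P) - (Q - P) o\<^sub>C\<^sub>L P"
      by (rule cblinfun_eqI) (simp add: S W cblinfun_rep cblinfun_linear P Q algebra_simps)
    then have "norm S \<le> norm (Q o\<^sub>C\<^sub>L (Q - P)) + norm ((Q - P) o\<^sub>C\<^sub>L P)"
      by (simp add: norm_triangle_ineq4)
    also have "\<dots> \<le> norm Q * norm (Q - P) + norm (Q - P) * norm P"
      by (intro add_mono norm_cblinfun_compose)
    finally have "norm S \<le> norm (Q - P) * (norm P + norm Q)" by (simp add: algebra_simps)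
    then show ?thesis
      by (meson mult_right_mono norm_cblinfun_apply norm_ge_zero order_trans)
  qed
  obtain W' :: "'a \<Rightarrow>\<^sub>C\<^sub>L 'a" where W': "\<And>x. W' x - S (W' x) = x" "\<And>x. W' (x - S x) = x"
    by (rule neumann_inverse[OF bound _ close]) auto
  show ?thesis
  proof (intro exI conjI allI impI)
    fix x
    show "W (W' x) = x" using W'(1)[of x] by (simp add: S)
    show "W' (W x) = x" using W'(2)[of x] by (simp add: S)
    show "Q (W x) = W (P x)" by (simp add: W cblinfun_linear P Q)
    show "W (\<theta> x) = \<theta> (W x)"
      if "\<forall>x. P (\<theta> x) = \<theta> (P x) \<and> Q (\<theta> x) = \<theta> (Q x)" for \<theta> :: "'a \<Rightarrow>\<^sub>C\<^sub>L 'a"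
      using that by (simp add: W cblinfun_linear)
  qed
qed

lemma finite_rank_conj:
  fixes W :: "'a :: complex_normed_vector \<Rightarrow>\<^sub>C\<^sub>L 'a"
  assumes F: "finite_rank F" and G: "\<And>x. G x = W (F (V x))"
  shows "finite_rank G"
proof -
  obtain B where B: "finite B" "range F \<subseteq> cspan B" using F unfolding finite_rank_def by blast
  have "W v \<in> cspan (W ` B)" if "v \<in> cspan B" for v
    using that
  proof (induction rule: complex_vector.span_induct_alt)
    case (step c x y)
    then show ?case
      by (simp add: cblinfun_linear complex_vector.span_add complex_vector.span_scale complex_vector.span_base)
  qed (simp add: cblinfun_linear complex_vector.span_zero)
  then have "range G \<subseteq> cspan (W ` B)" using B(2) G by auto
  then show ?thesis using B(1) unfolding finite_rank_def by blast
qed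

text \<open>Replacing each pair \<open>\<phi> k\<close>, \<open>e k\<close> by
  \<open>\<phi> k\<close> composed with \<open>W'\<close> and \<open>W (e k)\<close> preserves the
  number t. With the inverse replacement, F and G admit exactly the same t, so the two definite
  descriptions coincide.\<close>

lemma finite_rank_trace_conj:
  fixes W W' :: "'a :: complex_normed_vector \<Rightarrow>\<^sub>C\<^sub>L 'a"
  assumes WW': "\<And>x. W (cblinfun_apply W' x) = x" and W'W: "\<And>x. W' (cblinfun_apply W x) = x"
    and G: "\<And>x. G x = W (F (W' x))"
  shows "finite_rank_trace G = finite_rank_trace F"
proof -
  define rep where "rep F t \<longleftrightarrow> (\<exists>(n :: nat) (\<phi> :: nat \<Rightarrow> 'a \<Rightarrow>\<^sub>C\<^sub>L complex) e.
     (\<forall>x. F x = (\<Sum>k<n. \<phi> k x *\<^sub>C e k)) \<and> t = (\<Sum>k<n. \<phi> k (e k)))" for F :: "'a \<Rightarrow> 'a" and t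
  have conj: "rep G t" if "rep F t" and G: "\<And>x. G x = W (F (cblinfun_apply W' x))"
    and W'W: "\<And>x. W' (cblinfun_apply W x) = x"
    for F G t and W W' :: "'a \<Rightarrow>\<^sub>C\<^sub>L 'a"
  proof -
    obtain n :: nat and \<phi> :: "nat \<Rightarrow> 'a \<Rightarrow>\<^sub>C\<^sub>L complex" and e
      where F: "\<And>x. F x = (\<Sum>k<n. \<phi> k x *\<^sub>C e k)" and t: "t = (\<Sum>k<n. \<phi> k (e k))"
      using \<open>rep F t\<close> unfolding rep_def by blast
    show ?thesis
      unfolding rep_def
      by (rule exI[of _ n], rule exI[of _ "\<lambda>k. \<phi> k o\<^sub>C\<^sub>L W'"], rule exI[of _ "\<lambda>k. W (e k)"])
         (simp add: G F t cblinfun_rep cblinfun_sum cblinfun_apply_scaleC W'W)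
  qed
  have "rep G = rep F"
  proof (intro ext iffI)
    fix t
    show "rep G t" if "rep F t" using that G W'W by (rule conj)
    have "F x = W' (G (W x))" for x by (simp add: G W'W)
    then show "rep F t" if "rep G t" using that WW' by (intro conj[of G t F W' W]) auto
  qed
  then show ?thesis
    unfolding finite_rank_trace_def rep_def fun_eq_iff by presburger
qed

lemma finite_rank_sum:
  assumes "finite I" "\<And>i. i \<in> I \<Longrightarrow> finite_rank (cblinfun_apply (F i))"
  shows "finite_rank (cblinfun_apply (sum F I))"
proof -
  obtain B where B: "\<And>i. i \<in> I \<Longrightarrow> finite (B i)" "\<And>i. i \<in> I \<Longrightarrow> range (F i) \<subseteq> cspan (B i)"
    using assms(2) unfolding finite_rank_def by metis
  have "F i x \<in> cspan (\<Union>i\<in>I. B i)" if "i \<in> I" for i x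
    using B(2)[OF that] complex_vector.span_mono[of "B i" "\<Union>i\<in>I. B i"] that by blast
  then have "range (sum F I) \<subseteq> cspan (\<Union>i\<in>I. B i)"
    by (auto simp: sum_cblinfun_apply intro: complex_vector.span_sum)
  moreover have "finite (\<Union>i\<in>I. B i)" using assms(1) B(1) by simp
  ultimately show ?thesis unfolding finite_rank_def by (intro exI conjI)
qed

section \<open>Stability of the Riesz projector\<close>

text \<open>Projectors of disjoint discs annihilate each other. Absorption later passes finite rank
  from the sum down to each summand.\<close>

lemma (in separated_operator) sum_riesz_circle:
  assumes E: "finite E" and r: "0 < r" and s: "\<And>\<mu>. \<mu> \<in> E \<Longrightarrow> sphere \<mu> r \<inter> spectrum A = {}"
    and disj: "\<And>\<mu> \<mu>'. \<mu> \<in> E \<Longrightarrow> \<mu>' \<in> E \<Longrightarrow> \<mu> \<noteq> \<mu>' \<Longrightarrow> cball \<mu> r \<inter> cball \<mu>' r = {}"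
  defines "Q \<equiv> \<Sum>\<mu>\<in>E. riesz_circle A \<mu> r"
  shows sum_riesz_circle_absorb: "\<mu> \<in> E \<Longrightarrow> Q (riesz_circle A \<mu> r x) = riesz_circle A \<mu> r x"
    and sum_riesz_circle_idem: "Q (Q x) = Q x"
proof -
  have 1: "Q (riesz_circle A \<mu> r x) = riesz_circle A \<mu> r x" if \<mu>: "\<mu> \<in> E" for \<mu> x
  proof -
    have "Q (riesz_circle A \<mu> r x) = (\<Sum>\<nu>\<in>E. if \<nu> = \<mu> then riesz_circle A \<mu> r x else 0)"
      unfolding Q_def sum_cblinfun_apply
      using riesz_circle_idem[OF r s[OF \<mu>]] riesz_circle_disjoint[OF r s[OF \<mu>] r s disj]
      using \<mu> by (intro sum.cong) auto
    then show ?thesis using E \<mu> by simp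
  qed
  then show "\<mu> \<in> E \<Longrightarrow> Q (riesz_circle A \<mu> r x) = riesz_circle A \<mu> r x" by blast
  have "Q x = (\<Sum>\<mu>\<in>E. riesz_circle A \<mu> r x)" by (simp add: Q_def sum_cblinfun_apply)
  then show "Q (Q x) = Q x" by (simp add: cblinfun_sum 1)
qed

lemma norm_riesz_circle_diff:
  fixes A A' :: "'a :: {complex_normed_vector, banach} operator"
  assumes "separated_operator A" "separated_operator A'" and r: "0 < r"
    and s: "sphere c r \<inter> spectrum A = {}" "sphere c r \<inter> spectrum A' = {}"
    and b: "\<And>z. z \<in> sphere c r \<Longrightarrow> norm (resolvent A' z - resolvent A z) \<le> b"
  shows "norm (riesz_circle A' c r - riesz_circle A c r) \<le> r * b"
proof -
  let ?I = "\<lambda>A :: 'a operator. contour_integralC (circlepath c r) (resolvent A)"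
  have "norm (?I A' - ?I A) \<le> 2 * pi * r * b"
    using assms by (intro norm_contour_integralC_diff separated_operator.continuous_on_resolvent)
  moreover have "norm (riesz_circle A' c r - riesz_circle A c r) = 1 / (2 * pi) * norm (?I A' - ?I A)"
    unfolding riesz_circle_def complex_vector.scale_right_diff_distrib[symmetric] norm_scaleC
    by (simp add: norm_divide norm_mult)
  ultimately show ?thesis
    using divide_right_mono[of "norm (?I A' - ?I A)" "2 * pi * r * b" "2 * pi"] by simp
qed

definition op_commutes :: "('a :: complex_normed_vector \<Rightarrow>\<^sub>C\<^sub>L 'a) \<Rightarrow> 'a operator \<Rightarrow> bool" where
  "op_commutes \<theta> A \<longleftrightarrow> (\<forall>x\<in>Dom A. \<theta> x \<in> Dom A \<and> App A (\<theta> x) = \<theta> (App A x))"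

context separated_operator
begin

text \<open>An accumulation point would belong to the closed spectrum without being isolated in
  it.\<close>

lemma finite_spectrum_compact:
  assumes disc: "discrete_spectrum A" and K: "compact K"
  shows "finite (spectrum A \<inter> K)"
proof (rule ccontr)
  assume "infinite (spectrum A \<inter> K)"
  then obtain x where x: "x islimpt (spectrum A \<inter> K)"
    using K unfolding compact_eq_Bolzano_Weierstrass by (metis Int_lower2)
  then have "x islimpt spectrum A" by (rule islimpt_subset) simp
  moreover from this have "x \<in> spectrum A" using closed_spectrum closed_limpt by blast
  ultimately show False
    using disc unfolding discrete_spectrum_def discrete_eigenvalue_def isolated_in_islimpt_iff by blast
qed

lemma disjoint_discs:
  assumes disc: "discrete_spectrum A" and E: "E = spectrum A \<inter> U" "finite E" and U: "open U"
  obtains r where "0 < r" "\<And>\<mu>. \<mu> \<in> E \<Longrightarrow> cball \<mu> r \<subseteq> U" "\<And>\<mu>. \<mu> \<in> E \<Longrightarrow> cball \<mu> r \<inter> spectrum A = {\<mu>}"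
    "\<And>\<mu> \<mu>'. \<mu> \<in> E \<Longrightarrow> \<mu>' \<in> E \<Longrightarrow> \<mu> \<noteq> \<mu>' \<Longrightarrow> cball \<mu> r \<inter> cball \<mu>' r = {}"
proof -
  have "\<exists>e>0. cball \<mu> e \<subseteq> U \<and> cball \<mu> e \<inter> spectrum A = {\<mu>}" if "\<mu> \<in> E" for \<mu>
    using isolated_disc[of \<mu> U] that E U disc
    unfolding discrete_spectrum_def discrete_eigenvalue_def by (metis IntE)
  then obtain e where e: "\<And>\<mu>. \<mu> \<in> E \<Longrightarrow> e \<mu> > 0" "\<And>\<mu>. \<mu> \<in> E \<Longrightarrow> cball \<mu> (e \<mu>) \<subseteq> U"
    "\<And>\<mu>. \<mu> \<in> E \<Longrightarrow> cball \<mu> (e \<mu>) \<inter> spectrum A = {\<mu>}"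
    by metis
  \<comment> \<open>Half of the smallest isolating radius: if two of the discs met, one centre would
    lie in the isolating disc of the other. The element 1 keeps \<open>Min\<close> meaningful when E
    is empty.\<close>
  define r where "r = Min (insert 1 (e ` E)) / 2"
  have r: "0 < r" using e(1) E(2) by (auto simp: r_def)
  have re: "2 * r \<le> e \<mu>" if "\<mu> \<in> E" for \<mu>
    using that E(2) by (auto simp: r_def intro: Min_le)
  show thesis
  proof
    show "0 < r" by (rule r)
    fix \<mu> assume \<mu>: "\<mu> \<in> E"
    have sub: "cball \<mu> r \<subseteq> cball \<mu> (e \<mu>)" using re[OF \<mu>] r by auto
    then show "cball \<mu> r \<subseteq> U" using e(2)[OF \<mu>] by blast
    show "cball \<mu> r \<inter> spectrum A = {\<mu>}" using sub e(3)[OF \<mu>] r by auto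
    fix \<mu>' assume \<mu>': "\<mu>' \<in> E" "\<mu> \<noteq> \<mu>'"
    then have "\<mu>' \<in> spectrum A" using E(1) by simp
    then have "\<mu>' \<notin> cball \<mu> (e \<mu>)" using e(3)[OF \<mu>] \<mu>'(2) by (metis IntI singletonD)
    then have far: "dist \<mu> \<mu>' > 2 * r" using re[OF \<mu>] by simp
    show "cball \<mu> r \<inter> cball \<mu>' r = {}"
    proof (rule ccontr)
      assume "cball \<mu> r \<inter> cball \<mu>' r \<noteq> {}"
      then obtain z where "dist \<mu> z \<le> r" "dist \<mu>' z \<le> r" by auto
      then show False using far dist_triangle2[of \<mu> \<mu>' z] by linarith
    qed
  qed
qed

text \<open>A relatively small perturbation becomes small in norm after the resolvent, which is
  bounded into the domain with the graph norm; compactness makes the bound uniform in z.\<close>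

lemma resolvent_relative_perturbation:
  assumes K: "compact K" "K \<inter> spectrum A = {}" and \<eta>: "0 < \<eta>"
  obtains \<epsilon> where "0 < \<epsilon>"
    "\<And>A' z. linear_operator A' \<Longrightarrow> Dom A' = Dom A \<Longrightarrow>
       (\<And>x. x \<in> Dom A \<Longrightarrow> norm (App A' x - App A x) \<le> \<epsilon> * (norm (App A x) + norm x)) \<Longrightarrow>
       z \<in> K \<Longrightarrow> z \<notin> spectrum A' \<and> norm (resolvent A' z - resolvent A z) \<le> \<eta>"
proof -
  have "compact (resolvent A ` K)"
    using K by (intro compact_continuous_image continuous_on_resolvent)
  then obtain M where M: "M > 0" "\<And>z. z \<in> K \<Longrightarrow> norm (resolvent A z) \<le> M"
    using bounded_pos[of "resolvent A ` K"] compact_imp_bounded by auto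
  obtain Z where Z: "Z > 0" "\<And>z. z \<in> K \<Longrightarrow> norm z \<le> Z"
    using bounded_pos[of K] compact_imp_bounded[OF K(1)] by auto
  \<comment> \<open>For x = R y the equation A x = z x - y gives norm (A x) + norm x \<le> (Z M + 1
    + M) norm y.\<close>
  define C where "C = Z * M + 1 + M"
  have C: "C > 0" using M Z by (simp add: C_def add_pos_pos)
  define q where "q = min (1 / 2) (\<eta> / (2 * M))"
  have q: "0 < q" "q \<le> 1 / 2" "q \<le> \<eta> / (2 * M)" using \<eta> M by (simp_all add: q_def)
  show thesis
  proof
    show "0 < q / C" using q C by simp
    fix A' :: "'a operator" and z
    assume A': "linear_operator A'" "Dom A' = Dom A"
      and close: "\<And>x. x \<in> Dom A \<Longrightarrow> norm (App A' x - App A x) \<le> q / C * (norm (App A x) + norm x)"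
      and z: "z \<in> K"
    have zA: "z \<notin> spectrum A" using z K by auto
    have "norm (z *\<^sub>C resolvent A z y - App A' (resolvent A z y) - y) \<le> q * norm y" for y
    proof -
      let ?x = "resolvent A z y"
      have x: "norm ?x \<le> M * norm y"
        using norm_cblinfun_apply mult_right_mono[OF M(2)[OF z] norm_ge_zero] by (rule order_trans)
      have Ax: "App A ?x = z *\<^sub>C ?x - y"
        using resolvent_right[OF zA, of y] by (simp add: algebra_simps)
      then have "norm (App A ?x) \<le> norm z * norm ?x + norm y"
        by (metis norm_scaleC norm_triangle_ineq4)
      also have "\<dots> \<le> Z * (M * norm y) + norm y"
        using Z(2)[OF z] Z(1) x by (intro add_right_mono mult_mono) auto
      finally have "norm (App A ?x) + norm ?x \<le> C * norm y"
        using x by (simp add: C_def algebra_simps)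
      then have le: "q / C * (norm (App A ?x) + norm ?x) \<le> q / C * (C * norm y)"
        using q C by (intro mult_left_mono) auto
      have "z *\<^sub>C ?x - App A' ?x - y = - (App A' ?x - App A ?x)"
        by (simp add: Ax)
      then have "norm (z *\<^sub>C ?x - App A' ?x - y) = norm (App A' ?x - App A ?x)"
        by (simp only: norm_minus_cancel)
      also have "\<dots> \<le> q / C * (C * norm y)"
        using close[OF resolvent_in_Dom[OF zA]] le by (rule order_trans)
      finally show ?thesis using C by simp
    qed
    from spectrum_perturb[OF A' zA _ q(2) this] q
    have *: "z \<notin> spectrum A'" "norm (resolvent A' z - resolvent A z) \<le> 2 * q * norm (resolvent A z)"
      by auto
    have "2 * q * norm (resolvent A z) \<le> 2 * (\<eta> / (2 * M)) * M"
      using q M(1) M(2)[OF z] \<eta> by (intro mult_mono) auto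
    with * show "z \<notin> spectrum A' \<and> norm (resolvent A' z - resolvent A z) \<le> \<eta>"
      using M(1) by simp
  qed
qed

text \<open>One \<epsilon>, depending on A and the curve alone, serves every bounded symmetry at
  once.\<close>

theorem riesz_projector_stable:
  assumes disc: "discrete_spectrum A"
    and \<Gamma>: "path \<Gamma>" "path_image \<Gamma> \<inter> spectrum A = {}"
  obtains \<epsilon> where "0 < \<epsilon>"
    "\<And>A'. linear_operator A' \<Longrightarrow> Dom A' = Dom A \<Longrightarrow>
       (\<And>x. x \<in> Dom A \<Longrightarrow> norm (App A' x - App A x) \<le> \<epsilon> * (norm (App A x) + norm x)) \<Longrightarrow>
       riesz_admissible \<Gamma> A' \<and>
       (\<forall>\<theta> :: 'a \<Rightarrow>\<^sub>C\<^sub>L 'a. op_commutes \<theta> A \<longrightarrow> op_commutes \<theta> A' \<longrightarrow>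
          finite_rank_trace (\<lambda>x. riesz_projector \<Gamma> A' (\<theta> x)) =
          finite_rank_trace (\<lambda>x. riesz_projector \<Gamma> A (\<theta> x)))"
proof -
  let ?I = "inside (path_image \<Gamma>)"
  define E where "E = spectrum A \<inter> ?I"
  have closed_\<Gamma>: "closed (path_image \<Gamma>)" using \<Gamma>(1) by (simp add: closed_path_image)
  have open_I: "open ?I" using closed_\<Gamma> by (rule open_inside)
  have K0: "compact (path_image \<Gamma> \<union> ?I)"
    unfolding compact_eq_bounded_closed
    using \<Gamma>(1) by (simp add: bounded_path_image bounded_inside closed_path_image_Un_inside)
  have E: "finite E"
    using finite_spectrum_compact[OF disc K0] by (rule finite_subset[rotated]) (auto simp: E_def)
  obtain r where r: "0 < r" and rI: "\<And>\<mu>. \<mu> \<in> E \<Longrightarrow> cball \<mu> r \<subseteq> ?I"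
    and r1: "\<And>\<mu>. \<mu> \<in> E \<Longrightarrow> cball \<mu> r \<inter> spectrum A = {\<mu>}"
    and r2: "\<And>\<mu> \<mu>'. \<mu> \<in> E \<Longrightarrow> \<mu>' \<in> E \<Longrightarrow> \<mu> \<noteq> \<mu>' \<Longrightarrow> cball \<mu> r \<inter> cball \<mu>' r = {}"
    using disjoint_discs[OF disc E_def E open_I] by blast
  \<comment> \<open>The region to be kept free of spectrum: it contains the curve and all circles,
    and it misses the spectrum of A because the encircled part sits in the removed discs.\<close>
  define K where "K = (path_image \<Gamma> \<union> ?I) - (\<Union>\<mu>\<in>E. ball \<mu> r)"
  have K: "compact K" unfolding K_def using K0 by (intro compact_diff) auto
  have KA: "K \<inter> spectrum A = {}" using \<Gamma>(2) r by (auto simp: K_def E_def)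
  have \<Gamma>K: "path_image \<Gamma> \<subseteq> K"
  proof
    fix z assume z: "z \<in> path_image \<Gamma>"
    then have "z \<notin> ?I" using inside_no_overlap[of "path_image \<Gamma>"] by blast
    then have "z \<notin> ball \<mu> r" if "\<mu> \<in> E" for \<mu>
      using rI[OF that] ball_subset_cball by blast
    then show "z \<in> K" using z by (auto simp: K_def)
  qed
  have sphere_K: "sphere \<mu> r \<subseteq> K" if \<mu>: "\<mu> \<in> E" for \<mu>
  proof
    fix z assume z: "z \<in> sphere \<mu> r"
    have "z \<notin> ball \<mu>' r" if "\<mu>' \<in> E" for \<mu>'
      using z r2[OF \<mu> that] by (cases "\<mu> = \<mu>'") auto
    then show "z \<in> K" using z rI[OF \<mu>] by (auto simp: K_def)
  qed
  have s: "sphere \<mu> r \<inter> spectrum A = {}" if "\<mu> \<in> E" for \<mu>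
    using sphere_K[OF that] KA by blast
  define P where "P = (\<Sum>\<mu>\<in>E. riesz_circle A \<mu> r)"
  have eig: "riesz_circle A \<mu> r = eigenprojection A \<mu>" if "\<mu> \<in> E" for \<mu>
    by (rule riesz_circle_eq_eigenprojection) (use r r1[OF that] in auto)
  then have P: "riesz_projector \<Gamma> A = P"
    by (simp add: riesz_projector_def encircled_spectrum_def P_def flip: E_def)
  have P_fin: "finite_rank P"
    unfolding P_def using E eig disc
    by (intro finite_rank_sum) (auto simp: E_def discrete_spectrum_def discrete_eigenvalue_def)
  \<comment> \<open>As norm Q will be at most norm P + 1, this value meets the hypothesis of
    \<open>similar_projections\<close>.\<close>
  define \<delta> where "\<delta> = 1 / (2 * norm P + 2)"
  have \<delta>: "0 < \<delta>" "\<delta> \<le> 1" "\<delta> * (2 * norm P + 1) < 1"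
    by (auto simp: \<delta>_def field_simps add_pos_nonneg)
  \<comment> \<open>Each circle adds at most r \<eta> to norm (Q - P); the summand 1 covers the case
    that no eigenvalue is encircled.\<close>
  define \<eta> where "\<eta> = \<delta> / (r * (card E + 1))"
  have \<eta>: "0 < \<eta>" using \<delta> r by (simp add: \<eta>_def)
  obtain \<epsilon> where \<epsilon>: "0 < \<epsilon>" and res: "\<And>A' z. linear_operator A' \<Longrightarrow> Dom A' = Dom A \<Longrightarrow>
       (\<And>x. x \<in> Dom A \<Longrightarrow> norm (App A' x - App A x) \<le> \<epsilon> * (norm (App A x) + norm x)) \<Longrightarrow>
       z \<in> K \<Longrightarrow> z \<notin> spectrum A' \<and> norm (resolvent A' z - resolvent A z) \<le> \<eta>"
    using resolvent_relative_perturbation[OF K KA \<eta>] by blast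
  show thesis
  proof (rule that[OF \<epsilon>])
    fix A' :: "'a operator"
    assume A': "linear_operator A'" "Dom A' = Dom A"
      and close: "\<And>x. x \<in> Dom A \<Longrightarrow> norm (App A' x - App A x) \<le> \<epsilon> * (norm (App A x) + norm x)"
    interpret A': separated_operator A'
    proof
      show "linear_operator A'" by (rule A'(1))
      show "x = 0" if "\<And>\<phi> :: 'a \<Rightarrow>\<^sub>C\<^sub>L complex. \<phi> x = 0" for x :: 'a
        using that by (rule separating)
    qed
    have KA': "z \<notin> spectrum A'" "norm (resolvent A' z - resolvent A z) \<le> \<eta>" if "z \<in> K" for z
      using res[OF A' close that] by auto
    have s': "sphere \<mu> r \<inter> spectrum A' = {}" if "\<mu> \<in> E" for \<mu>
      using sphere_K[OF that] KA' by blast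
    define Q where "Q = (\<Sum>\<mu>\<in>E. riesz_circle A' \<mu> r)"
    have "norm (Q - P) \<le> (\<Sum>\<mu>\<in>E. r * \<eta>)"
      unfolding Q_def P_def sum_subtractf[symmetric]
    proof (rule sum_norm_le)
      fix \<mu> assume \<mu>: "\<mu> \<in> E"
      show "norm (riesz_circle A' \<mu> r - riesz_circle A \<mu> r) \<le> r * \<eta>"
        by (rule norm_riesz_circle_diff[OF separated_operator_axioms A'.separated_operator_axioms r s[OF \<mu>] s'[OF \<mu>]])
           (use sphere_K[OF \<mu>] KA' in blast)
    qed
    also have "r * \<eta> = \<delta> / (card E + 1)"
      using r by (simp add: \<eta>_def)
    also have "(\<Sum>\<mu>\<in>E. \<delta> / (card E + 1)) = card E / (card E + 1) * \<delta>"
      by simp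
    also have "\<dots> \<le> 1 * \<delta>"
      using \<delta> by (intro mult_right_mono) (auto simp: field_simps)
    finally have QP: "norm (Q - P) \<le> \<delta>" by simp
    then have "norm Q \<le> norm P + 1"
      using norm_triangle_ineq2[of Q P] \<delta> by linarith
    then have "norm (Q - P) * (norm P + norm Q) \<le> \<delta> * (2 * norm P + 1)"
      using QP \<delta> by (intro mult_mono) auto
    then have QP': "norm (Q - P) * (norm P + norm Q) < 1" using \<delta> by linarith
    have P_idem: "P (P x) = P x" for x
      unfolding P_def by (rule sum_riesz_circle_idem[OF E r s r2])
    have Q_idem: "Q (Q x) = Q x" for x
      unfolding Q_def by (rule A'.sum_riesz_circle_idem[OF E r s' r2])
    obtain W W' :: "'a \<Rightarrow>\<^sub>C\<^sub>L 'a" where W: "\<forall>x. W (W' x) = x" "\<forall>x. W' (W x) = x" "\<forall>x. Q (W x) = W (P x)"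
      "\<forall>\<theta> :: 'a \<Rightarrow>\<^sub>C\<^sub>L 'a. (\<forall>x. P (\<theta> x) = \<theta> (P x) \<and> Q (\<theta> x) = \<theta> (Q x)) \<longrightarrow> (\<forall>x. W (\<theta> x) = \<theta> (W x))"
      using similar_projections[OF P_idem Q_idem QP'] by (elim exE conjE) (rule that)
    have "Q x = W (P (W' x))" for x using W(1,3) by metis
    then have Q_fin: "finite_rank Q" by (rule finite_rank_conj[OF P_fin])
    have fin: "finite_rank (riesz_circle A' \<mu> r)" if \<mu>: "\<mu> \<in> E" for \<mu>
    proof -
      have "riesz_circle A' \<mu> r x \<in> range Q" for x
        using A'.sum_riesz_circle_absorb[OF E r s' r2 \<mu>, of x] unfolding Q_def by (metis rangeI)
      then show ?thesis
        using Q_fin unfolding finite_rank_def by (meson image_subsetI subset_trans)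
    qed
    \<comment> \<open>Spectrum of A' inside the curve cannot lie in K, hence lies in the discs,
      which in turn lie inside the curve.\<close>
    have enc: "encircled_spectrum \<Gamma> A' = (\<Union>\<mu>\<in>E. spectrum A' \<inter> ball \<mu> r)"
    proof -
      have "spectrum A' \<inter> ?I \<subseteq> (\<Union>\<mu>\<in>E. ball \<mu> r)" using KA'(1) unfolding K_def by blast
      moreover have "(\<Union>\<mu>\<in>E. ball \<mu> r) \<subseteq> ?I" using rI ball_subset_cball by blast
      ultimately show ?thesis unfolding encircled_spectrum_def by blast
    qed
    have fin_disc: "finite (spectrum A' \<inter> ball \<mu> r)" if "\<mu> \<in> E" for \<mu>
      using A'.finite_disc_spectrum[OF r s'[OF that] fin[OF that]] .
    have adm: "riesz_admissible \<Gamma> A'"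
      unfolding riesz_admissible_def
    proof (intro conjI ballI)
      show "path_image \<Gamma> \<inter> spectrum A' = {}" using \<Gamma>K KA' by blast
      show "finite (encircled_spectrum \<Gamma> A')" unfolding enc using E fin_disc by blast
      show "discrete_eigenvalue A' \<mu>" if "\<mu> \<in> encircled_spectrum \<Gamma> A'" for \<mu>
        using that A'.discrete_eigenvalue_disc[OF r s' fin] unfolding enc by blast
    qed
    have "riesz_projector \<Gamma> A' = (\<Sum>\<mu>\<in>E. \<Sum>\<nu>\<in>spectrum A' \<inter> ball \<mu> r. eigenprojection A' \<nu>)"
      unfolding riesz_projector_def enc
    proof (rule sum.UNION_disjoint)
      have "ball \<mu> r \<inter> ball \<mu>' r = {}" if "\<mu> \<in> E" "\<mu>' \<in> E" "\<mu> \<noteq> \<mu>'" for \<mu> \<mu>'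
        using r2[OF that] ball_subset_cball by blast
      then show "\<forall>\<mu>\<in>E. \<forall>\<mu>'\<in>E. \<mu> \<noteq> \<mu>' \<longrightarrow> (spectrum A' \<inter> ball \<mu> r) \<inter> (spectrum A' \<inter> ball \<mu>' r) = {}"
        by blast
    qed (use E fin_disc in auto)
    \<comment> \<open>An eigenvalue of A may have split; the eigenprojections of its fragments add
      up to the integral over its circle.\<close>
    also have "\<dots> = Q"
      unfolding Q_def by (intro sum.cong refl A'.riesz_circle_eq_sum[symmetric] r s' fin_disc)
    finally have Q: "riesz_projector \<Gamma> A' = Q" .
    have W_comm: "\<forall>x. W (\<theta> x) = \<theta> (W x)" if \<theta>: "op_commutes \<theta> A" "op_commutes \<theta> A'"
      for \<theta> :: "'a \<Rightarrow>\<^sub>C\<^sub>L 'a"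
    proof -
      have "riesz_circle A \<mu> r (\<theta> x) = \<theta> (riesz_circle A \<mu> r x)" if \<mu>: "\<mu> \<in> E" for \<mu> x
      proof (rule riesz_circle_commute[OF r s[OF \<mu>]])
        fix z x assume "z \<in> sphere \<mu> r"
        then have "z \<notin> spectrum A" using s[OF \<mu>] by blast
        then show "resolvent A z (\<theta> x) = \<theta> (resolvent A z x)"
          by (rule resolvent_intertwine) (use \<theta>(1) in \<open>simp add: op_commutes_def\<close>)
      qed
      then have "P (\<theta> x) = \<theta> (P x)" for x
        by (simp add: P_def sum_cblinfun_apply cblinfun_sum)
      moreover have "riesz_circle A' \<mu> r (\<theta> x) = \<theta> (riesz_circle A' \<mu> r x)" if \<mu>: "\<mu> \<in> E" for \<mu> x
      proof (rule A'.riesz_circle_commute[OF r s'[OF \<mu>]])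
        fix z x assume "z \<in> sphere \<mu> r"
        then have "z \<notin> spectrum A'" using s'[OF \<mu>] by blast
        then show "resolvent A' z (\<theta> x) = \<theta> (resolvent A' z x)"
          by (rule resolvent_intertwine) (use \<theta>(2) in \<open>simp add: op_commutes_def\<close>)
      qed
      then have "Q (\<theta> x) = \<theta> (Q x)" for x
        by (simp add: Q_def sum_cblinfun_apply cblinfun_sum)
      ultimately have "\<forall>x. P (\<theta> x) = \<theta> (P x) \<and> Q (\<theta> x) = \<theta> (Q x)" by simp
      then show ?thesis by (rule W(4)[THEN spec, THEN mp])
    qed
    have "finite_rank_trace (\<lambda>x. Q (\<theta> x)) = finite_rank_trace (\<lambda>x. P (\<theta> x))"
      if "op_commutes \<theta> A" "op_commutes \<theta> A'" for \<theta> :: "'a \<Rightarrow>\<^sub>C\<^sub>L 'a"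
    proof (rule finite_rank_trace_conj)
      fix x
      show "W (W' x) = x" "W' (W x) = x" using W(1,2) by auto
      \<comment> \<open>Commutation gives \<theta> = W \<theta> W^-1, and with Q W = W P it follows
        that Q \<theta> = W (P \<theta>) W^-1.\<close>
      have "\<theta> x = W (\<theta> (W' x))" using W(1) W_comm[OF that] by metis
      then show "Q (\<theta> x) = W (P (\<theta> (W' x)))" using W(3) by simp
    qed
    then show "riesz_admissible \<Gamma> A' \<and>
       (\<forall>\<theta> :: 'a \<Rightarrow>\<^sub>C\<^sub>L 'a. op_commutes \<theta> A \<longrightarrow> op_commutes \<theta> A' \<longrightarrow>
          finite_rank_trace (\<lambda>x. riesz_projector \<Gamma> A' (\<theta> x)) =
          finite_rank_trace (\<lambda>x. riesz_projector \<Gamma> A (\<theta> x)))"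
      unfolding Q P using adm by blast
  qed
qed

end

section \<open>Dirac operators\<close>

lemma bounded_linear_cinner: "bounded_linear (cinner (x :: 'a :: complex_inner))"
\<comment> \<open>The factor 2 pays for estimating real and imaginary parts separately by the real
  Cauchy-Schwarz inequality.\<close>
proof (rule bounded_linear_intro[where K = "2 * norm x"])
  fix y z :: 'a and r :: real
  show "cinner x (y + z) = cinner x y + cinner x z" by (rule cinner_add_right)
  show "cinner x (r *\<^sub>R y) = r *\<^sub>R cinner x y"
    by (simp add: cinner_scaleC_right scaleR_conv_of_real flip: scaleC_of_real)
  have "\<bar>Re (cinner x y)\<bar> \<le> norm x * norm y"
    by (simp add: Re_cinner Cauchy_Schwarz_ineq2)
  moreover have "\<bar>Im (cinner x y)\<bar> \<le> norm x * norm y"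
  proof -
    have "Im (cinner x y) = inner x ((- \<i>) *\<^sub>C y)"
      unfolding Re_cinner[symmetric] cinner_scaleC_right by simp
    then show ?thesis
      using Cauchy_Schwarz_ineq2[of x "(- \<i>) *\<^sub>C y"] by (simp add: norm_scaleC)
  qed
  ultimately show "norm (cinner x y) \<le> norm y * (2 * norm x)"
    using cmod_le[of "cinner x y"] by (simp add: algebra_simps)
qed

text \<open>Among the functionals F -> <w, F v> the choice w = x v already forces x v = 0.\<close>

lemma cblinfun_separating:
  fixes x :: "'r :: complex_normed_vector \<Rightarrow>\<^sub>C\<^sub>L 'l :: complex_hilbert"
  assumes "\<And>\<phi> :: ('r \<Rightarrow>\<^sub>C\<^sub>L 'l) \<Rightarrow>\<^sub>C\<^sub>L complex. cblinfun_apply \<phi> x = 0"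
  shows "x = 0"
proof (rule cblinfun_eqI)
  fix v
  have "cblinfun_apply (CBlinfun (\<lambda>F. cinner (x v) (cblinfun_apply F v))) = (\<lambda>F. cinner (x v) (F v))"
    by (rule CBlinfun_inverse)
       (auto simp: cblinfun_rep cinner_scaleC_right scaleC_complex_def
         intro!: bounded_linear_compose[OF bounded_linear_cinner] bounded_linear_apply_cblinfun)
  then have "cinner (x v) (x v) = 0" using assms by metis
  then have "inner (x v) (x v) = 0" by (metis Re_cinner zero_complex.simps(1))
  then show "x v = cblinfun_apply 0 v" by (simp add: cblinfun_rep)
qed

section \<open>Linearity and parity of sums and products of unbounded operators\<close>

lemma linear_operator_add: "linear_operator A \<Longrightarrow> linear_operator B \<Longrightarrow> linear_operator (op_add A B)"
  unfolding linear_operator_def op_add_def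
  by (auto simp: complex_vector.subspace_inter scaleC_add_right)

lemma linear_operator_scale: "linear_operator A \<Longrightarrow> linear_operator (op_scale c A)"
  unfolding linear_operator_def op_scale_def
  by (auto simp: scaleC_add_right scaleC_scaleC mult.commute)

lemma linear_operator_zero: "linear_operator A \<Longrightarrow> App A 0 = 0"
  unfolding linear_operator_def complex_vector.subspace_def
  by (metis complex_vector.scale_zero_left)

lemma linear_operator_comp:
  assumes "linear_operator A" "linear_operator B"
  shows "linear_operator (op_comp A B)"
  using assms linear_operator_zero[of B]
  unfolding linear_operator_def op_comp_def complex_vector.subspace_def by auto

definition odd_under :: "('a :: complex_normed_vector \<Rightarrow>\<^sub>C\<^sub>L 'a) \<Rightarrow> 'a operator \<Rightarrow> bool" where
  "odd_under \<theta> D \<longleftrightarrow> (\<forall>x\<in>Dom D. \<theta> x \<in> Dom D \<and> \<theta> (App D x) = - App D (\<theta> x))"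

lemma linear_operator_minus:
  assumes "linear_operator A" "x \<in> Dom A"
  shows "- x \<in> Dom A" "App A (- x) = - App A x"
proof -
  have "(-1) *\<^sub>C x \<in> Dom A \<and> App A ((-1) *\<^sub>C x) = (-1) *\<^sub>C App A x"
    using assms unfolding linear_operator_def complex_vector.subspace_def by blast
  then show "- x \<in> Dom A" "App A (- x) = - App A x"
    by (simp_all add: complex_vector.scale_minus_left scaleC_one)
qed

text \<open>The two signs cancel; linearity of A carries the first sign through A and through its
  domain.\<close>

lemma op_commutes_comp:
  assumes A: "linear_operator A" "odd_under \<theta> A" and B: "odd_under \<theta> B"
  shows "op_commutes \<theta> (op_comp A B)"
  unfolding op_commutes_def
proof
  fix x assume "x \<in> Dom (op_comp A B)"
  then have x: "x \<in> Dom B" "App B x \<in> Dom A" by (auto simp: op_comp_def)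
  have "App B (\<theta> x) = - \<theta> (App B x)" "\<theta> x \<in> Dom B"
    using B x(1) by (auto simp: odd_under_def)
  moreover have "\<theta> (App B x) \<in> Dom A" "\<theta> (App A (App B x)) = - App A (\<theta> (App B x))"
    using A(2) x(2) by (auto simp: odd_under_def)
  ultimately show "\<theta> x \<in> Dom (op_comp A B) \<and> App (op_comp A B) (\<theta> x) = \<theta> (App (op_comp A B) x)"
    using linear_operator_minus[OF A(1)] by (simp add: op_comp_def)
qed

lemma op_commutes_add: "op_commutes \<theta> A \<Longrightarrow> op_commutes \<theta> B \<Longrightarrow> op_commutes \<theta> (op_add A B)"
  by (auto simp: op_commutes_def op_add_def cblinfun_linear)

lemma op_commutes_scale: "op_commutes \<theta> A \<Longrightarrow> op_commutes \<theta> (op_scale c A)"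
  by (auto simp: op_commutes_def op_scale_def cblinfun_linear)

section \<open>Size of the perturbation of the square\<close>

lemma perturbed_square_close:
  assumes B: "relatively_bounded (op_square \<Delta>) (anticommutator \<Delta>' \<Delta>)"
    and C: "relatively_bounded (op_square \<Delta>) (op_square \<Delta>')" and \<epsilon>: "0 < \<epsilon>"
  obtains \<rho> :: real where "0 < \<rho>"
    "\<And>t x. \<bar>t\<bar> < \<rho> \<Longrightarrow> x \<in> Dom (op_square \<Delta>) \<Longrightarrow>
      norm (App (perturbed_square \<Delta> \<Delta>' (complex_of_real t)) x - App (op_square \<Delta>) x)
        \<le> \<epsilon> * (norm (App (op_square \<Delta>) x) + norm x)"
proof -
  let ?A = "op_square \<Delta>" and ?B = "anticommutator \<Delta>' \<Delta>" and ?C = "op_square \<Delta>'"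
  obtain a b where ab: "a > 0" "b > 0"
    "\<And>x. x \<in> Dom ?A \<Longrightarrow> norm (App ?B x) \<le> a * norm (App ?A x) + b * norm x"
    using B unfolding relatively_bounded_def by blast
  obtain a' b' where ab': "a' > 0" "b' > 0"
    "\<And>x. x \<in> Dom ?A \<Longrightarrow> norm (App ?C x) \<le> a' * norm (App ?A x) + b' * norm x"
    using C unfolding relatively_bounded_def by blast
  define c where "c = a + b + a' + b'"
  have c: "c > 0" using ab ab' by (simp add: c_def)
  show thesis
  proof
    \<comment> \<open>Below 1 the quadratic term is dominated by a linear one; below \<epsilon> / c
      the linear factor absorbs all four constants of relative boundedness.\<close>
    show "0 < min 1 (\<epsilon> / c)" using \<epsilon> c by simp
    fix t x assume t: "\<bar>t\<bar> < min 1 (\<epsilon> / c)" and x: "x \<in> Dom ?A"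
    let ?n = "norm (App ?A x)" and ?m = "norm x"
    have "App (perturbed_square \<Delta> \<Delta>' t) x - App ?A x = complex_of_real t *\<^sub>C App ?B x + (complex_of_real t)\<^sup>2 *\<^sub>C App ?C x"
      by (simp add: perturbed_square_def op_add_def op_scale_def)
    then have "norm (App (perturbed_square \<Delta> \<Delta>' t) x - App ?A x) \<le> \<bar>t\<bar> * norm (App ?B x) + \<bar>t\<bar>\<^sup>2 * norm (App ?C x)"
      by (metis norm_triangle_ineq norm_scaleC norm_of_real norm_power)
    also have "\<dots> \<le> \<bar>t\<bar> * norm (App ?B x) + \<bar>t\<bar> * norm (App ?C x)"
      using t mult_right_mono[of "\<bar>t\<bar>" 1 "\<bar>t\<bar>"]
      by (intro add_left_mono mult_right_mono) (auto simp: power2_eq_square abs_mult[symmetric])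
    also have "\<dots> \<le> \<bar>t\<bar> * (c * (?n + ?m))"
    proof -
      have "a * ?n + b * ?m + (a' * ?n + b' * ?m) \<le> c * (?n + ?m)"
        using ab ab' by (simp add: c_def algebra_simps)
      then have "norm (App ?B x) + norm (App ?C x) \<le> c * (?n + ?m)"
        using ab(3)[OF x] ab'(3)[OF x] by linarith
      then have "\<bar>t\<bar> * (norm (App ?B x) + norm (App ?C x)) \<le> \<bar>t\<bar> * (c * (?n + ?m))"
        by (rule mult_left_mono) simp
      then show ?thesis by (simp add: distrib_left)
    qed
    also have "\<dots> \<le> \<epsilon> * (?n + ?m)"
    proof -
      have "\<bar>t\<bar> * c \<le> \<epsilon>" using t c by (simp add: field_simps)
      then show ?thesis by (metis add_nonneg_nonneg mult.assoc mult_right_mono norm_ge_zero)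
    qed
    finally show "norm (App (perturbed_square \<Delta> \<Delta>' t) x - App ?A x) \<le> \<epsilon> * (?n + ?m)" .
  qed
qed

text \<open>The chirality acts through a plain function on the operator space; in this form it
  becomes a bounded operator to which the stability theorem applies.\<close>

lemma mat_act_op_CBlinfun: "cblinfun_apply (CBlinfun (mat_act_op M)) = mat_act_op M"
proof -
  obtain K where K: "0 \<le> K" "\<And>w :: 'b ^ 'c. norm (mat_act M w) \<le> norm w * K"
    using bounded_linear.nonneg_bounded[OF bounded_linear_mat_act[of M]] by blast
  show ?thesis
  proof (rule CBlinfun_apply)
    fix x y :: "'a \<Rightarrow>\<^sub>C\<^sub>L ('b ^ 'c)" and c
    show "mat_act_op M (x + y) = mat_act_op M x + mat_act_op M y"
      by (rule cblinfun_eqI)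
         (simp add: mat_act_op.rep_eq cblinfun_rep linear_add bounded_linear.linear[OF bounded_linear_mat_act])
    show "mat_act_op M (c *\<^sub>C x) = c *\<^sub>C mat_act_op M x"
      by (rule cblinfun_eqI) (simp add: mat_act_op.rep_eq cblinfun_rep mat_act_scaleC)
    show "norm (mat_act_op M x) \<le> K * norm x"
    proof (rule norm_cblinfun_bound)
      fix v
      have "norm (mat_act M (x v)) \<le> norm (x v) * K" by (rule K)
      also have "\<dots> \<le> norm x * norm v * K" by (intro mult_right_mono norm_cblinfun_apply K)
      finally show "norm (mat_act_op M x v) \<le> K * norm x * norm v"
        by (simp add: mat_act_op.rep_eq mult_ac)
    qed (use K in simp)
  qed
qed

theorem proposition2:
  fixes d :: nat
    and \<delta> :: "nat \<Rightarrow> complex ^ 'n ^ 'n"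
    and XL XL' :: "nat \<Rightarrow> 'l :: complex_hilbert operator"
    and XR XR' :: "nat \<Rightarrow> 'r :: complex_hilbert operator"
    and \<Delta> \<Delta>' :: "('r \<Rightarrow>\<^sub>C\<^sub>L ('l ^ 'n)) operator"
    and \<Gamma> :: "real \<Rightarrow> complex"
  assumes "even d" "2 \<le> d" "d \<le> 8"
    and "CARD('n) = 2 ^ ((10 - d) div 2)"
    and "separable_space (euclidean :: 'l topology)"
    and "separable_space (euclidean :: 'r topology)"
    and "gamma_matrices d \<delta>"
    and "\<And>i. i \<in> {d..9} \<Longrightarrow> self_adjoint (XL i) \<and> self_adjoint (XR i)"
    and "dirac_operator d \<delta> XL XR \<Delta>"
    and "closed_operator (op_square \<Delta>)"
    and "discrete_spectrum (op_square \<Delta>)"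
    and "\<And>i. i \<in> {d..9} \<Longrightarrow> self_adjoint (XL' i) \<and> self_adjoint (XR' i)"
    and "dirac_operator d \<delta> XL' XR' \<Delta>'"
    and "relatively_bounded (op_square \<Delta>) (op_square \<Delta>')"
    and "relatively_bounded (op_square \<Delta>) (anticommutator \<Delta>' \<Delta>)"
    and "simple_path \<Gamma>" "pathfinish \<Gamma> = pathstart \<Gamma>"
    and "0 \<in> inside (path_image \<Gamma>)"
    and "path_image \<Gamma> \<inter> spectrum (op_square \<Delta>) = {}"
  shows "\<exists>U :: real set. open U \<and> 0 \<in> U \<and>
    (\<forall>t\<in>U. riesz_admissible \<Gamma> (perturbed_square \<Delta> \<Delta>' (complex_of_real t)) \<and>
      chirality_index d \<delta> \<Gamma> (perturbed_square \<Delta> \<Delta>' (complex_of_real t)) =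
      chirality_index d \<delta> \<Gamma> (op_square \<Delta>))"
proof -
  let ?A = "op_square \<Delta>" and ?A' = "\<lambda>t. perturbed_square \<Delta> \<Delta>' (complex_of_real t)"
  define \<theta> :: "('r \<Rightarrow>\<^sub>C\<^sub>L ('l ^ 'n)) \<Rightarrow>\<^sub>C\<^sub>L ('r \<Rightarrow>\<^sub>C\<^sub>L ('l ^ 'n))"
    where "\<theta> = CBlinfun (mat_act_op (chirality_matrix d \<delta>))"
  have \<theta>: "cblinfun_apply \<theta> = mat_act_op (chirality_matrix d \<delta>)"
    unfolding \<theta>_def by (rule mat_act_op_CBlinfun)
  have lin: "linear_operator \<Delta>" "linear_operator \<Delta>'"
    using assms(9,13) by (auto simp: dirac_operator_def)
  have odd: "odd_under \<theta> \<Delta>" "odd_under \<theta> \<Delta>'"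
    using assms(9,13) by (auto simp: dirac_operator_def odd_under_def Let_def \<theta>)
  have lin_A: "linear_operator ?A"
    unfolding op_square_def by (intro linear_operator_comp lin)
  have comm_A: "op_commutes \<theta> ?A"
    unfolding op_square_def by (intro op_commutes_comp lin odd)
  have lin_A': "linear_operator (?A' t)" for t
    unfolding perturbed_square_def anticommutator_def op_square_def
    by (intro linear_operator_add linear_operator_scale linear_operator_comp lin)
  have comm_A': "op_commutes \<theta> (?A' t)" for t
    unfolding perturbed_square_def anticommutator_def op_square_def
    by (intro op_commutes_add op_commutes_scale op_commutes_comp lin odd)
  \<comment> \<open>Relative boundedness contains the inclusion of domains, so the intersection
    formed by \<open>op_add\<close> collapses to the domain of the unperturbed square.\<close>
  have Dom_A': "Dom (?A' t) = Dom ?A" for t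
    using assms(14,15) by (auto simp: perturbed_square_def op_add_def op_scale_def relatively_bounded_def)
  interpret separated_operator ?A
  proof
    show "linear_operator ?A" by (rule lin_A)
    show "x = 0" if "\<And>\<phi> :: ('r \<Rightarrow>\<^sub>C\<^sub>L ('l ^ 'n)) \<Rightarrow>\<^sub>C\<^sub>L complex. \<phi> x = 0" for x
      using that by (rule cblinfun_separating)
  qed
  obtain \<epsilon> where \<epsilon>: "0 < \<epsilon>" and stable: "\<And>A'. linear_operator A' \<Longrightarrow> Dom A' = Dom ?A \<Longrightarrow>
       (\<And>x. x \<in> Dom ?A \<Longrightarrow> norm (App A' x - App ?A x) \<le> \<epsilon> * (norm (App ?A x) + norm x)) \<Longrightarrow>
       riesz_admissible \<Gamma> A' \<and>
       (\<forall>\<theta>. op_commutes \<theta> ?A \<longrightarrow> op_commutes \<theta> A' \<longrightarrow>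
          finite_rank_trace (\<lambda>x. riesz_projector \<Gamma> A' (\<theta> x)) =
          finite_rank_trace (\<lambda>x. riesz_projector \<Gamma> ?A (\<theta> x)))"
    using riesz_projector_stable[OF assms(11) simple_path_imp_path[OF assms(16)] assms(19)] by blast
  obtain \<rho> :: real where \<rho>: "0 < \<rho>" and close: "\<And>t x. \<bar>t\<bar> < \<rho> \<Longrightarrow> x \<in> Dom ?A \<Longrightarrow>
      norm (App (?A' t) x - App ?A x) \<le> \<epsilon> * (norm (App ?A x) + norm x)"
    using perturbed_square_close[OF assms(15,14) \<epsilon>] by blast
  show ?thesis
  proof (intro exI[of _ "ball 0 \<rho>"] conjI ballI)
    fix t :: real assume "t \<in> ball 0 \<rho>"
    then have "\<bar>t\<bar> < \<rho>" by simp
    from stable[OF lin_A' Dom_A' close[OF this]] comm_A comm_A'[of t]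
    show "riesz_admissible \<Gamma> (?A' t)"
      "chirality_index d \<delta> \<Gamma> (?A' t) = chirality_index d \<delta> \<Gamma> ?A"
      by (auto simp: chirality_index_def simp flip: \<theta>)
  qed (use \<rho> in auto)
qed

end
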